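(* Let $\varphi,\psi:\Sigma\to\mathbb{R}$ be Hölder continuous with $\psi>0$. Let $\mathcal{C}'\subset\mathcal{C}\subset\Sigma^*$ and suppose that $\mathcal{C}'$ is finitely irreducible and representable by loops, and that $\mathcal{C}$ is compactly finitely embeddable into $\mathcal{C}'$. Then $$\sup_{K}\ \mathcal{P}_{\psi,K}(\varphi,\mathcal{C})=\mathcal{P}_\psi(\varphi,\mathcal{C}'),$$ where the supremum is over all compact $\sigma$-invariant subsets $K\subset\Sigma$. In particular, $(\psi,\varphi,\mathcal{C})$ satisfies the exhausting principle if and only if $\mathcal{P}_\psi(\varphi,\mathcal{C})=\mathcal{P}_\psi(\varphi,\mathcal{C}')$.
   Context: Markov shift: $I\subset\mathbb{N}$ is an alphabet (finite or infinite), $A\in\{0,1\}^{I\times I}$ an incidence matrix, $\Sigma=\{\omega\in I^{\mathbb{N}}: A_{\omega_i\omega_{i+1}}=1\ \forall i\in\mathbb N\}$, $\sigma$ the left shift. $\Sigma^*$ is the set of all finite non-empty words over $I$ whose consecutive letters $ij$ satisfy $A_{ij}=1$; $|\omega|$ is the length of $\omega\in\Sigma^*$; $[\omega]=\{\tau\in\Sigma:\tau\text{ begins with }\omega\}$. $\Sigma$ is topologized by the metrics $d_\alpha(\omega,\omega')=e^{-\alpha|\omega\wedge\omega'|}$, $\alpha>0$, where $\omega\wedge\omega'$ is the longest common initial block. Hölder continuity: $f:\Sigma\to\mathbb{R}$ is Hölder continuous if there are $\alpha>0$ and $V\ge0$ with $|f(\omega)-f(\omega')|\le V d_\alpha(\omega,\omega')$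 for all $\omega,\omega'\in\Sigma$ with $|\omega\wedge\omega'|\ge1$. Induced pressure: $$\mathcal{P}_\psi(\varphi,\mathcal{C})=\limsup_{T\to\infty}\frac1T\log\sum_{\omega\in\mathcal{C},\ T-\eta<S_\omega\psi\le T}\exp S_\omega\varphi\in[-\infty,\infty],\qquad S_\omega f=\sup_{\tau\in[\omega]}\sum_{k=0}^{|\omega|-1}f(\sigma^k\tau),$$ where $\eta>0$ is any fixed number (the value does not depend on $\eta$), and $\log 0=-\infty$, $\sup\emptyset=-\infty$. For a $\sigma$-invariant $K\subset\Sigma$, $K^*=\{\omega\in\Sigma^*:[\omega]\cap K\ne\emptyset\}$ and $\mathcal{P}_{\psi,K}(\varphi,\mathcal{C})=\mathcal{P}_{\psi|_K}(\varphi|_K,\mathcal{C}\cap K^* )$, where in the latter the suprema in $S_\omega$ are over $[\omega]\cap K$. The exhausting principle holds for $(\psi,\varphi,\mathcal{C})$ if there is a sequence $(K_n)$ of compact $\sigma$-invariant subsets of $\Sigma$ with $\lim_{n\to\infty}\mathcal{P}_{\psi,K_n}(\varphi,\mathcal{C})=\mathcal{P}_\psi(\varphi,\mathcal{C})$. A collection $\mathcal{D}\subset\Sigma^*$ is representable by loops if (i) $\omega_1,\omega_2\in\mathcal{D}$ and $\omega_1\omega_2\in\Sigma^*$ imply $\omega_1\omega_2\in\mathcal{D}$, and (ii) $\omega_1\omega_2\in\mathcal{D}$ and $\omega_2\omega_3\in\mathcal{D}$ (non-empty words $\omega_1,\omega_2,\omega_3$) imply $\omega_2\in\mathcal{D}$.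 It is finitely irreducible if there is a finite set $\Lambda\subset\Sigma^*$ such that for all $C_1,C_2\in\mathcal{D}$ there is $D\in\Lambda\cup\{\emptyset\}$ ($\emptyset$ the empty word) with $C_1DC_2\in\mathcal{D}$. A collection $\mathcal{D}$ is finitely embeddable into $\mathcal{C}'$ if there is a finite set $\Lambda\subset\Sigma^*$ such that for every $\omega\in\mathcal{D}$ there are $\tau_1,\tau_2\in\Lambda$ with $\tau_1\omega\tau_2\in\mathcal{C}'$. $\mathcal{C}$ is compactly finitely embeddable into $\mathcal{C}'$ if $\mathcal{C}\cap K^*$ is finitely embeddable into $\mathcal{C}'$ for every compact $\sigma$-invariant $K\subset\Sigma$. *)

theory Defs
  imports "HOL-Analysis.Analysis" "HOL-Real_Asymp.Real_Asymp"
begin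

text \<open>
  Infinite words are functions \<open>nat \<Rightarrow> nat\<close>, finite words are lists.  The incidence matrix
  \<open>A\<close> is only ever read on \<open>I \<times> I\<close>.
\<close>

definition shift_space :: "nat set \<Rightarrow> (nat \<Rightarrow> nat \<Rightarrow> nat) \<Rightarrow> (nat \<Rightarrow> nat) set" where
  "shift_space I A = {\<omega>. (\<forall>i. \<omega> i \<in> I) \<and> (\<forall>i. A (\<omega> i) (\<omega> (Suc i)) = 1)}"

definition left_shift :: "(nat \<Rightarrow> nat) \<Rightarrow> (nat \<Rightarrow> nat)" where
  "left_shift \<omega> = (\<lambda>i. \<omega> (Suc i))"

definition admissible_words :: "nat set \<Rightarrow> (nat \<Rightarrow> nat \<Rightarrow> nat) \<Rightarrow> nat list set" where
  "admissible_words I A =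
     {w. w \<noteq> [] \<and> set w \<subseteq> I \<and> (\<forall>i. Suc i < length w \<longrightarrow> A (w ! i) (w ! Suc i) = 1)}"

text \<open>
  The cylinder of \<open>w\<close> relative to a set \<open>X\<close> of infinite words: \<open>X\<close> is the whole shift
  space for \<open>[\<omega>]\<close>, and an invariant subset \<open>K\<close> for \<open>[\<omega>] \<inter> K\<close>.
\<close>

definition cylinder :: "(nat \<Rightarrow> nat) set \<Rightarrow> nat list \<Rightarrow> (nat \<Rightarrow> nat) set" where
  "cylinder X w = {\<tau> \<in> X. \<forall>i<length w. \<tau> i = w ! i}"


text \<open>The length of the longest common initial block; it is \<open>\<infinity>\<close> for equal words.\<close>

definition meet_length :: "(nat \<Rightarrow> nat) \<Rightarrow> (nat \<Rightarrow> nat) \<Rightarrow> enat" where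
  "meet_length \<omega> \<omega>' = (SUP n \<in> {n. \<forall>i<n. \<omega> i = \<omega>' i}. enat n)"

definition shift_dist :: "real \<Rightarrow> (nat \<Rightarrow> nat) \<Rightarrow> (nat \<Rightarrow> nat) \<Rightarrow> real" where
  "shift_dist \<alpha> \<omega> \<omega>' =
     (case meet_length \<omega> \<omega>' of enat n \<Rightarrow> exp (- \<alpha> * real n) | \<infinity> \<Rightarrow> 0)"

text \<open>
  All the metrics \<open>shift_dist \<alpha>\<close> with \<open>\<alpha> > 0\<close> induce the same topology (lemma
  \<open>shift_topology_eq\<close> below), so the choice \<open>\<alpha> = 1\<close> is immaterial.
\<close>

definition shift_topology :: "nat set \<Rightarrow> (nat \<Rightarrow> nat \<Rightarrow> nat) \<Rightarrow> (nat \<Rightarrow> nat) topology" where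
  "shift_topology I A = Metric_space.mtopology (shift_space I A) (shift_dist 1)"

lemma enat_le_meet_length_iff:
  "enat n \<le> meet_length \<omega> \<omega>' \<longleftrightarrow> (\<forall>i<n. \<omega> i = \<omega>' i)"
proof
  assume le: "enat n \<le> meet_length \<omega> \<omega>'"
  show "\<forall>i<n. \<omega> i = \<omega>' i"
  proof (rule ccontr)
    assume "\<not> (\<forall>i<n. \<omega> i = \<omega>' i)"
    then obtain i where i: "i < n" "\<omega> i \<noteq> \<omega>' i" by blast
    then have "m \<le> i" if "\<forall>j<m. \<omega> j = \<omega>' j" for m
      using that not_le by blast
    then have "meet_length \<omega> \<omega>' \<le> enat i"
      unfolding meet_length_def by (intro SUP_least) auto
    with le i show False
      by (meson enat_ord_simps(1) leD le_trans order_trans)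
  qed
next
  assume "\<forall>i<n. \<omega> i = \<omega>' i"
  then show "enat n \<le> meet_length \<omega> \<omega>'"
    unfolding meet_length_def by (intro SUP_upper) auto
qed

lemma meet_length_eq_infinity_iff: "meet_length \<omega> \<omega>' = \<infinity> \<longleftrightarrow> \<omega> = \<omega>'"
proof
  assume "meet_length \<omega> \<omega>' = \<infinity>"
  then have "\<forall>n. \<forall>i<n. \<omega> i = \<omega>' i"
    using enat_le_meet_length_iff[of _ \<omega> \<omega>'] by simp
  then show "\<omega> = \<omega>'" by blast
next
  assume "\<omega> = \<omega>'"
  then have "enat n \<le> meet_length \<omega> \<omega>'" for n
    by (simp add: enat_le_meet_length_iff)
  then show "meet_length \<omega> \<omega>' = \<infinity>"
    by (metis enat.exhaust enat_ord_simps(1) not_less_eq_eq order_refl)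
qed

lemma meet_length_commute: "meet_length \<omega> \<omega>' = meet_length \<omega>' \<omega>"
  unfolding meet_length_def by (simp add: eq_commute)

lemma shift_dist_less_exp_iff:
  assumes "\<alpha> > 0"
  shows "shift_dist \<alpha> \<omega> \<omega>' < exp (- \<alpha> * real n) \<longleftrightarrow> (\<forall>i<Suc n. \<omega> i = \<omega>' i)"
proof -
  have "shift_dist \<alpha> \<omega> \<omega>' < exp (- \<alpha> * real n) \<longleftrightarrow> enat (Suc n) \<le> meet_length \<omega> \<omega>'"
    using assms by (cases "meet_length \<omega> \<omega>'") (auto simp: shift_dist_def)
  then show ?thesis by (simp add: enat_le_meet_length_iff)
qed

lemma shift_dist_nonneg: "0 \<le> shift_dist \<alpha> \<omega> \<omega>'"
  by (simp add: shift_dist_def split: enat.split)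

lemma Metric_space_shift_dist:
  assumes "\<alpha> > 0"
  shows "Metric_space X (shift_dist \<alpha>)"
proof
  fix x y z
  show "0 \<le> shift_dist \<alpha> x y" by (rule shift_dist_nonneg)
  show "shift_dist \<alpha> x y = shift_dist \<alpha> y x"
    by (simp add: shift_dist_def meet_length_commute)
  show "shift_dist \<alpha> x y = 0 \<longleftrightarrow> x = y"
    by (simp add: shift_dist_def split: enat.split flip: meet_length_eq_infinity_iff)
  show "shift_dist \<alpha> x z \<le> shift_dist \<alpha> x y + shift_dist \<alpha> y z"
  proof (cases "meet_length x z")
    case infinity
    then show ?thesis using shift_dist_nonneg[of \<alpha> x y] shift_dist_nonneg[of \<alpha> y z]
      by (simp add: shift_dist_def)
  next
    case (enat n)
    then have "\<not> (\<forall>i<Suc n. x i = z i)"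
      by (simp flip: enat_le_meet_length_iff)
    then have "\<not> (\<forall>i<Suc n. x i = y i) \<or> \<not> (\<forall>i<Suc n. y i = z i)"
      by metis
    then have "exp (- \<alpha> * real n) \<le> shift_dist \<alpha> x y \<or> exp (- \<alpha> * real n) \<le> shift_dist \<alpha> y z"
      using shift_dist_less_exp_iff[OF assms] by (meson not_le)
    moreover have "shift_dist \<alpha> x z = exp (- \<alpha> * real n)"
      using enat by (simp add: shift_dist_def)
    ultimately show ?thesis
      using shift_dist_nonneg[of \<alpha> x y] shift_dist_nonneg[of \<alpha> y z] by linarith
  qed
qed

lemma shift_topology_eq:
  assumes "\<alpha> > 0"
  shows "shift_topology I A = Metric_space.mtopology (shift_space I A) (shift_dist \<alpha>)"
proof -
  have open_iff: "openin (Metric_space.mtopology X (shift_dist \<beta>)) U \<longleftrightarrow>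
      U \<subseteq> X \<and> (\<forall>x\<in>U. \<exists>n. \<forall>y\<in>X. (\<forall>i<Suc n. x i = y i) \<longrightarrow> y \<in> U)"
    if "\<beta> > 0" for \<beta> X U
  proof -
    interpret Metric_space X "shift_dist \<beta>" using that by (rule Metric_space_shift_dist)
    have "(\<exists>r>0. mball x r \<subseteq> U) \<longleftrightarrow> (\<exists>n. \<forall>y\<in>X. (\<forall>i<Suc n. x i = y i) \<longrightarrow> y \<in> U)"
      if "x \<in> X" for x
    proof
      assume "\<exists>r>0. mball x r \<subseteq> U"
      then obtain r where r: "r > 0" "mball x r \<subseteq> U" by blast
      have "(\<lambda>n. exp (- \<beta> * real n)) \<longlonglongrightarrow> 0"
        using \<open>\<beta> > 0\<close> by real_asymp
      then have "eventually (\<lambda>n. exp (- \<beta> * real n) < r) sequentially"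
        using r(1) by (rule order_tendstoD)
      then obtain n where n: "exp (- \<beta> * real n) < r"
        by (meson eventually_happens' sequentially_bot)
      have "y \<in> U" if "y \<in> X" "\<forall>i<Suc n. x i = y i" for y
      proof -
        have "shift_dist \<beta> x y < exp (- \<beta> * real n)"
          using that shift_dist_less_exp_iff[OF \<open>\<beta> > 0\<close>] by blast
        with n r(2) \<open>x \<in> X\<close> \<open>y \<in> X\<close> show ?thesis by auto
      qed
      then show "\<exists>n. \<forall>y\<in>X. (\<forall>i<Suc n. x i = y i) \<longrightarrow> y \<in> U" by blast
    next
      assume "\<exists>n. \<forall>y\<in>X. (\<forall>i<Suc n. x i = y i) \<longrightarrow> y \<in> U"
      then obtain n where n: "\<forall>y\<in>X. (\<forall>i<Suc n. x i = y i) \<longrightarrow> y \<in> U" by blast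
      have "mball x (exp (- \<beta> * real n)) \<subseteq> U"
        using n shift_dist_less_exp_iff[OF \<open>\<beta> > 0\<close>] by fastforce
      then show "\<exists>r>0. mball x r \<subseteq> U" using exp_gt_zero by blast
    qed
    then show ?thesis unfolding openin_mtopology by blast
  qed
  show ?thesis unfolding shift_topology_def topology_eq
    using open_iff[of 1] open_iff[OF assms] by simp
qed


definition holder_continuous ::
  "nat set \<Rightarrow> (nat \<Rightarrow> nat \<Rightarrow> nat) \<Rightarrow> ((nat \<Rightarrow> nat) \<Rightarrow> real) \<Rightarrow> bool" where
  "holder_continuous I A f \<longleftrightarrow>
     (\<exists>\<alpha>>0. \<exists>V\<ge>0. \<forall>\<omega>\<in>shift_space I A. \<forall>\<omega>'\<in>shift_space I A.
        meet_length \<omega> \<omega>' \<ge> 1 \<longrightarrow> \<bar>f \<omega> - f \<omega>'\<bar> \<le> V * shift_dist \<alpha> \<omega> \<omega>')"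

text \<open>The supremum of the Birkhoff sums of \<open>f\<close> over the cylinder of \<open>w\<close> in \<open>X\<close>.\<close>

definition birkhoff_sup ::
  "(nat \<Rightarrow> nat) set \<Rightarrow> ((nat \<Rightarrow> nat) \<Rightarrow> real) \<Rightarrow> nat list \<Rightarrow> ereal" where
  "birkhoff_sup X f w =
     (SUP \<tau> \<in> cylinder X w. ereal (\<Sum>k<length w. f ((left_shift ^^ k) \<tau>)))"

definition exp_ereal :: "ereal \<Rightarrow> ennreal" where
  "exp_ereal x = (if x = -\<infinity> then 0 else if x = \<infinity> then \<infinity> else ennreal (exp (real_of_ereal x)))"

definition ln_ennreal :: "ennreal \<Rightarrow> ereal" where
  "ln_ennreal x =
     (if x = 0 then -\<infinity> else if x = \<infinity> then \<infinity> else ereal (ln (enn2real x)))"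

text \<open>
  The induced pressure of the system \<open>(X, left_shift)\<close>.  The window length \<open>\<eta>\<close> is an
  explicit parameter.  The sum is taken in \<open>[0, \<infinity>]\<close>, so it exists (possibly as \<open>\<infinity>\<close>)
  for every collection \<open>C\<close>.
\<close>

definition induced_pressure ::
  "real \<Rightarrow> (nat \<Rightarrow> nat) set \<Rightarrow> ((nat \<Rightarrow> nat) \<Rightarrow> real) \<Rightarrow> ((nat \<Rightarrow> nat) \<Rightarrow> real)
    \<Rightarrow> nat list set \<Rightarrow> ereal" where
  "induced_pressure \<eta> X \<psi> \<phi> C =
     Limsup at_top (\<lambda>T::real. ereal (1 / T) *
       ln_ennreal (\<Sum>\<^sub>\<infinity> w \<in> {w \<in> C. ereal (T - \<eta>) < birkhoff_sup X \<psi> w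
                                      \<and> birkhoff_sup X \<psi> w \<le> ereal T}.
                     exp_ereal (birkhoff_sup X \<phi> w)))"

definition words_meeting ::
  "nat set \<Rightarrow> (nat \<Rightarrow> nat \<Rightarrow> nat) \<Rightarrow> (nat \<Rightarrow> nat) set \<Rightarrow> nat list set" where
  "words_meeting I A K = {w \<in> admissible_words I A. cylinder (shift_space I A) w \<inter> K \<noteq> {}}"

text \<open>
  Shift invariance of \<open>K\<close> means \<open>\<sigma>(K) \<subseteq> K\<close>, i.e. that \<open>\<sigma>\<close> restricts to a
  map \<open>K \<rightarrow> K\<close>.
\<close>

definition compact_invariant ::
  "nat set \<Rightarrow> (nat \<Rightarrow> nat \<Rightarrow> nat) \<Rightarrow> (nat \<Rightarrow> nat) set \<Rightarrow> bool" where
  "compact_invariant I A K \<longleftrightarrow>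
     K \<subseteq> shift_space I A \<and> compactin (shift_topology I A) K \<and> left_shift ` K \<subseteq> K"

definition restricted_pressure ::
  "nat set \<Rightarrow> (nat \<Rightarrow> nat \<Rightarrow> nat) \<Rightarrow> real \<Rightarrow> (nat \<Rightarrow> nat) set \<Rightarrow> ((nat \<Rightarrow> nat) \<Rightarrow> real)
    \<Rightarrow> ((nat \<Rightarrow> nat) \<Rightarrow> real) \<Rightarrow> nat list set \<Rightarrow> ereal" where
  "restricted_pressure I A \<eta> K \<psi> \<phi> C = induced_pressure \<eta> K \<psi> \<phi> (C \<inter> words_meeting I A K)"

definition exhausting_principle ::
  "nat set \<Rightarrow> (nat \<Rightarrow> nat \<Rightarrow> nat) \<Rightarrow> real \<Rightarrow> ((nat \<Rightarrow> nat) \<Rightarrow> real)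
    \<Rightarrow> ((nat \<Rightarrow> nat) \<Rightarrow> real) \<Rightarrow> nat list set \<Rightarrow> bool" where
  "exhausting_principle I A \<eta> \<psi> \<phi> C \<longleftrightarrow>
     (\<exists>K :: nat \<Rightarrow> (nat \<Rightarrow> nat) set. (\<forall>n. compact_invariant I A (K n)) \<and>
        (\<lambda>n. restricted_pressure I A \<eta> (K n) \<psi> \<phi> C)
          \<longlonglongrightarrow> induced_pressure \<eta> (shift_space I A) \<psi> \<phi> C)"

definition representable_by_loops ::
  "nat set \<Rightarrow> (nat \<Rightarrow> nat \<Rightarrow> nat) \<Rightarrow> nat list set \<Rightarrow> bool" where
  "representable_by_loops I A D \<longleftrightarrow>
     (\<forall>w\<^sub>1\<in>D. \<forall>w\<^sub>2\<in>D. w\<^sub>1 @ w\<^sub>2 \<in> admissible_words I A \<longrightarrow> w\<^sub>1 @ w\<^sub>2 \<in> D) \<and>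
     (\<forall>w\<^sub>1 w\<^sub>2 w\<^sub>3. w\<^sub>1 \<noteq> [] \<longrightarrow> w\<^sub>2 \<noteq> [] \<longrightarrow> w\<^sub>3 \<noteq> [] \<longrightarrow>
        w\<^sub>1 @ w\<^sub>2 \<in> D \<longrightarrow> w\<^sub>2 @ w\<^sub>3 \<in> D \<longrightarrow> w\<^sub>2 \<in> D)"

definition finitely_irreducible ::
  "nat set \<Rightarrow> (nat \<Rightarrow> nat \<Rightarrow> nat) \<Rightarrow> nat list set \<Rightarrow> bool" where
  "finitely_irreducible I A D \<longleftrightarrow>
     (\<exists>L. finite L \<and> L \<subseteq> admissible_words I A \<and>
        (\<forall>u\<in>D. \<forall>v\<in>D. \<exists>d \<in> L \<union> {[]}. u @ d @ v \<in> D))"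

definition finitely_embeddable ::
  "nat set \<Rightarrow> (nat \<Rightarrow> nat \<Rightarrow> nat) \<Rightarrow> nat list set \<Rightarrow> nat list set \<Rightarrow> bool" where
  "finitely_embeddable I A D C' \<longleftrightarrow>
     (\<exists>L. finite L \<and> L \<subseteq> admissible_words I A \<and>
        (\<forall>w\<in>D. \<exists>t\<^sub>1\<in>L. \<exists>t\<^sub>2\<in>L. t\<^sub>1 @ w @ t\<^sub>2 \<in> C'))"

definition compactly_finitely_embeddable ::
  "nat set \<Rightarrow> (nat \<Rightarrow> nat \<Rightarrow> nat) \<Rightarrow> nat list set \<Rightarrow> nat list set \<Rightarrow> bool" where
  "compactly_finitely_embeddable I A C C' \<longleftrightarrow>
     (\<forall>K. compact_invariant I A K \<longrightarrow> finitely_embeddable I A (C \<inter> words_meeting I A K) C')"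

end

theory Submission
  imports Defs
begin

text \<open>
  Upper bound: by bounded distortion, sending \<open>\<omega>\<close> to \<open>\<tau>\<^sub>1\<omega>\<tau>\<^sub>2\<close> embeds \<open>\<C> \<inter> K\<^sup>*\<close> into \<open>\<C>'\<close> with
  bounded multiplicity and changes both Birkhoff suprema by a bounded amount, so only finitely many
  windows of \<open>\<C>'\<close> are hit.

  Lower bound: if the window at a large \<open>T\<close> carries mass more than \<open>exp (l' T)\<close>, so does a finite
  subset \<open>F\<close> of it. Fix a word \<open>u\<close> of \<open>\<C>'\<close> so long that \<open>\<psi>\<close> is bounded below on its cylinder, and
  form concatenations \<open>w\<^sub>1 d\<^sub>1 u d\<^sub>1' w\<^sub>2 d\<^sub>2 u d\<^sub>2' \<dots>\<close> of words of \<open>F\<close> inside \<open>\<C>'\<close>. The marker \<open>u\<close> makes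
  the decoding essentially unique: competing positions of a block boundary are all marked by \<open>u\<close>,
  each costs a fixed amount of \<open>\<psi>\<close>-mass, and together they may cost at most \<open>\<eta>\<close> plus a constant.
  All these words use finitely many letters, so the full set of sequences over these letters is a
  compact invariant set whose pressure is nearly \<open>l'\<close>.
\<close>

subsection \<open>Bounded distortion\<close>

definition bsum :: "((nat \<Rightarrow> nat) \<Rightarrow> real) \<Rightarrow> nat \<Rightarrow> (nat \<Rightarrow> nat) \<Rightarrow> real" where
  "bsum f n x = (\<Sum>k<n. f ((left_shift ^^ k) x))"

text \<open>Real version of \<open>birkhoff_sup\<close>. It is faithful only where the supremum is
  finite: on an empty cylinder the supremum is minus infinity and the value here is the default 0,
  so statements about suprema carry nonemptiness of cylinders along.\<close>

definition bval :: "(nat \<Rightarrow> nat) set \<Rightarrow> ((nat \<Rightarrow> nat) \<Rightarrow> real) \<Rightarrow> nat list \<Rightarrow> real" where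
  "bval X f w = real_of_ereal (birkhoff_sup X f w)"

text \<open>One constant \<open>M\<close> serves all lengths \<open>n\<close>. Most of the proof
  uses Hoelder continuity only in this form; continuity itself enters once more, in the choice of
  the marker word.\<close>

definition distortion_bound ::
  "nat set \<Rightarrow> (nat \<Rightarrow> nat \<Rightarrow> nat) \<Rightarrow> ((nat \<Rightarrow> nat) \<Rightarrow> real) \<Rightarrow> real \<Rightarrow> bool" where
  "distortion_bound I A f M \<longleftrightarrow> 0 \<le> M \<and>
     (\<forall>n. \<forall>x\<in>shift_space I A. \<forall>y\<in>shift_space I A.
        (\<forall>i<n. x i = y i) \<longrightarrow> \<bar>bsum f n x - bsum f n y\<bar> \<le> M)"

lemma left_shift_funpow: "(left_shift ^^ k) x = (\<lambda>i. x (i + k))"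
  by (induction k) (auto simp: left_shift_def)

lemma funpow_left_shift_in_shift_space:
  "x \<in> shift_space I A \<Longrightarrow> (left_shift ^^ k) x \<in> shift_space I A"
  by (auto simp: left_shift_funpow shift_space_def)

lemma bsum_add: "bsum f (m + n) x = bsum f m x + bsum f n ((left_shift ^^ m) x)"
proof -
  have "(left_shift ^^ k) ((left_shift ^^ m) x) = (left_shift ^^ (m + k)) x" for k
    by (simp add: left_shift_funpow add.commute add.left_commute)
  moreover have "sum g {..<m + n} = sum g {..<m} + (\<Sum>k<n. g (m + k))" for g :: "nat \<Rightarrow> real"
    by (induction n) (auto simp: algebra_simps)
  ultimately show ?thesis by (simp add: bsum_def)
qed

text \<open>The index is shifted by one: agreement on \<open>Suc n\<close> letters puts the distance
  strictly below \<open>exp (- \<alpha> * real n)\<close> and also secures the side condition that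
  at least one letter is shared.\<close>

lemma holder_continuousE:
  assumes "holder_continuous I A f"
  obtains \<alpha> V where "\<alpha> > 0" "V \<ge> 0"
    "\<And>x y n. \<lbrakk>x \<in> shift_space I A; y \<in> shift_space I A; \<forall>i<Suc n. x i = y i\<rbrakk>
       \<Longrightarrow> \<bar>f x - f y\<bar> \<le> V * exp (- \<alpha> * real n)"
proof -
  obtain \<alpha> V where *: "\<alpha> > 0" "V \<ge> 0"
    "\<And>x y. \<lbrakk>x \<in> shift_space I A; y \<in> shift_space I A; meet_length x y \<ge> 1\<rbrakk>
       \<Longrightarrow> \<bar>f x - f y\<bar> \<le> V * shift_dist \<alpha> x y"
    using assms unfolding holder_continuous_def by blast
  have "\<bar>f x - f y\<bar> \<le> V * exp (- \<alpha> * real n)"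
    if xy: "x \<in> shift_space I A" "y \<in> shift_space I A" "\<forall>i<Suc n. x i = y i" for x y n
  proof -
    have "meet_length x y \<ge> 1"
      using xy(3) by (simp add: one_enat_def enat_le_meet_length_iff)
    then have "\<bar>f x - f y\<bar> \<le> V * shift_dist \<alpha> x y" using * xy by blast
    also have "\<dots> \<le> V * exp (- \<alpha> * real n)"
      using shift_dist_less_exp_iff[OF *(1), of x y n] xy(3) *(2)
      by (intro mult_left_mono) (auto simp: less_imp_le)
    finally show ?thesis .
  qed
  then show thesis using that[OF *(1,2)] by blast
qed

text \<open>If two points share \<open>n\<close> letters, their \<open>k\<close>-th shifts share
  \<open>n - k\<close>, so the differences of the summands are dominated by a geometric series with
  ratio \<open>exp (- \<alpha>)\<close>, whose sum does not depend on \<open>n\<close>.\<close>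

lemma holder_distortion_bound:
  assumes "holder_continuous I A f"
  obtains M where "distortion_bound I A f M"
proof -
  obtain \<alpha> V where *: "\<alpha> > 0" "V \<ge> 0"
    "\<And>x y n. \<lbrakk>x \<in> shift_space I A; y \<in> shift_space I A; \<forall>i<Suc n. x i = y i\<rbrakk>
       \<Longrightarrow> \<bar>f x - f y\<bar> \<le> V * exp (- \<alpha> * real n)"
    using holder_continuousE[OF assms] by blast
  define q where "q = exp (- \<alpha>)"
  have q: "0 < q" "q < 1" using *(1) by (auto simp: q_def)
  have bound: "\<bar>bsum f n x - bsum f n y\<bar> \<le> V * (1 / (1 - q))"
    if xy: "x \<in> shift_space I A" "y \<in> shift_space I A" "\<forall>i<n. x i = y i" for n x y
  proof -
    have summand: "\<bar>f ((left_shift ^^ k) x) - f ((left_shift ^^ k) y)\<bar> \<le> V * q ^ (n - Suc k)"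
      if "k < n" for k
    proof -
      have "\<forall>i<Suc (n - Suc k). (left_shift ^^ k) x i = (left_shift ^^ k) y i"
        using xy(3) that by (auto simp: left_shift_funpow)
      from *(3)[OF funpow_left_shift_in_shift_space[OF xy(1)]
          funpow_left_shift_in_shift_space[OF xy(2)] this]
      show ?thesis by (simp add: q_def mult.commute flip: exp_of_nat_mult)
    qed
    have "\<bar>bsum f n x - bsum f n y\<bar>
        = \<bar>\<Sum>k<n. f ((left_shift ^^ k) x) - f ((left_shift ^^ k) y)\<bar>"
      by (simp add: bsum_def sum_subtractf)
    also have "\<dots> \<le> (\<Sum>k<n. V * q ^ (n - Suc k))"
      by (intro order_trans[OF sum_abs] sum_mono summand) auto
    also have "\<dots> = V * (\<Sum>k<n. q ^ k)"
      by (simp add: sum.nat_diff_reindex[of "\<lambda>k. q ^ k"] flip: sum_distrib_left)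
    also have "(\<Sum>k<n. q ^ k) \<le> 1 / (1 - q)"
      using q by (simp add: sum_gp_strict field_simps)
    finally show ?thesis using *(2) by (simp add: mult_left_mono)
  qed
  have "distortion_bound I A f (V * (1 / (1 - q)))"
    unfolding distortion_bound_def using bound q *(2) by auto
  then show thesis by (rule that)
qed

lemma cylinder_append_left: "\<tau> \<in> cylinder X (v @ w) \<Longrightarrow> \<tau> \<in> cylinder X v"
  by (auto simp: cylinder_def nth_append)

lemma cylinder_append_right:
  assumes "\<tau> \<in> cylinder (shift_space I A) (v @ w)"
  shows "(left_shift ^^ length v) \<tau> \<in> cylinder (shift_space I A) w"
proof -
  have "\<tau> \<in> shift_space I A" "\<forall>i<length v + length w. \<tau> i = (v @ w) ! i"
    using assms by (auto simp: cylinder_def)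
  then show ?thesis
    using funpow_left_shift_in_shift_space
    by (auto simp: cylinder_def left_shift_funpow nth_append)
qed

text \<open>A single orbit through the cylinder computes the supremum up to \<open>M\<close>; in
  particular the supremum is finite. Allowing any \<open>X\<close> inside the shift space covers
  both the full shift and the sets \<open>K\<close>.\<close>

lemma birkhoff_sup_bounds:
  assumes "distortion_bound I A f M" "X \<subseteq> shift_space I A" "\<tau> \<in> cylinder X w"
  shows "birkhoff_sup X f w = ereal (bval X f w)"
    and "bsum f (length w) \<tau> \<le> bval X f w"
    and "bval X f w \<le> bsum f (length w) \<tau> + M"
proof -
  have lo: "ereal (bsum f (length w) \<tau>) \<le> birkhoff_sup X f w"
    unfolding birkhoff_sup_def bsum_def using assms(3) by (intro SUP_upper) auto
  have hi: "birkhoff_sup X f w \<le> ereal (bsum f (length w) \<tau> + M)"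
    unfolding birkhoff_sup_def
  proof (rule SUP_least)
    fix x assume x: "x \<in> cylinder X w"
    have "\<bar>bsum f (length w) x - bsum f (length w) \<tau>\<bar> \<le> M"
      using assms x by (auto simp: distortion_bound_def cylinder_def subset_iff)
    then show "ereal (\<Sum>k<length w. f ((left_shift ^^ k) x)) \<le> ereal (bsum f (length w) \<tau> + M)"
      by (simp add: bsum_def)
  qed
  show eq: "birkhoff_sup X f w = ereal (bval X f w)"
    using lo hi by (cases "birkhoff_sup X f w") (auto simp: bval_def)
  show "bsum f (length w) \<tau> \<le> bval X f w" "bval X f w \<le> bsum f (length w) \<tau> + M"
    using lo hi unfolding eq by auto
qed

text \<open>An orbit through the long cylinder is cut at \<open>length v\<close>. Replacing its two
  pieces by orbits in the cylinders of \<open>v\<close> and \<open>w\<close> costs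
  \<open>2 * M\<close>, and passing from orbit sums to suprema costs at most \<open>2 * M\<close>
  more.\<close>

lemma bval_append:
  assumes "distortion_bound I A f M"
    and "X \<subseteq> shift_space I A" "Y \<subseteq> shift_space I A" "Z \<subseteq> shift_space I A"
    and "cylinder X (v @ w) \<noteq> {}" "cylinder Y v \<noteq> {}" "cylinder Z w \<noteq> {}"
  shows "\<bar>bval X f (v @ w) - bval Y f v - bval Z f w\<bar> \<le> 4 * M"
proof -
  obtain x y z where xyz: "x \<in> cylinder X (v @ w)" "y \<in> cylinder Y v" "z \<in> cylinder Z w"
    using assms by blast
  let ?x = "(left_shift ^^ length v) x"
  have x: "x \<in> cylinder (shift_space I A) (v @ w)"
    using xyz(1) assms(2) by (auto simp: cylinder_def)
  note x' = cylinder_append_left[OF x] cylinder_append_right[OF x]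
  have "\<bar>bsum f (length v) x - bsum f (length v) y\<bar> \<le> M"
    using assms(1,3) x'(1) xyz(2) by (auto simp: distortion_bound_def cylinder_def subset_iff)
  moreover have "\<bar>bsum f (length w) ?x - bsum f (length w) z\<bar> \<le> M"
    using assms(1,4) x'(2) xyz(3) by (auto simp: distortion_bound_def cylinder_def subset_iff)
  moreover have "bsum f (length (v @ w)) x = bsum f (length v) x + bsum f (length w) ?x"
    by (simp add: bsum_add)
  ultimately show ?thesis
    using birkhoff_sup_bounds(2,3)[OF assms(1,2) xyz(1)]
      birkhoff_sup_bounds(2,3)[OF assms(1,3) xyz(2)]
      birkhoff_sup_bounds(2,3)[OF assms(1,4) xyz(3)]
    by linarith
qed

lemma bval_append3:
  assumes "distortion_bound I A f M"
    and "X \<subseteq> shift_space I A" "Y \<subseteq> shift_space I A" "Z \<subseteq> shift_space I A"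
    and "cylinder X (u @ v @ w) \<noteq> {}" "cylinder Y u \<noteq> {}" "cylinder Z w \<noteq> {}"
  shows "\<bar>bval X f (u @ v @ w) - bval Y f u - bval (shift_space I A) f v - bval Z f w\<bar> \<le> 8 * M"
proof -
  let ?S = "shift_space I A"
  obtain x where "x \<in> cylinder X (u @ v @ w)" using assms(5) by blast
  then have "x \<in> cylinder ?S (u @ v @ w)" using assms(2) by (auto simp: cylinder_def)
  from cylinder_append_right[OF this] cylinder_append_left[OF cylinder_append_right[OF this]]
  have ne: "cylinder ?S (v @ w) \<noteq> {}" "cylinder ?S v \<noteq> {}" by blast+
  show ?thesis
    using bval_append[OF assms(1,2,3) order_refl assms(5,6) ne(1)]
      bval_append[OF assms(1) order_refl order_refl assms(4) ne assms(7)]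
    by linarith
qed

text \<open>Meant for words of \<open>K\<close> padded on both sides: only the middle word is
  measured in \<open>X\<close>, since the padded word need not meet \<open>X\<close>.\<close>

lemma bval_mid:
  assumes "distortion_bound I A f M" "X \<subseteq> shift_space I A"
    and "cylinder (shift_space I A) (u @ v @ w) \<noteq> {}" "cylinder X v \<noteq> {}"
  shows "\<bar>bval (shift_space I A) f (u @ v @ w) - bval (shift_space I A) f u
    - bval X f v - bval (shift_space I A) f w\<bar> \<le> 8 * M"
proof -
  let ?S = "shift_space I A"
  obtain x where x: "x \<in> cylinder ?S (u @ v @ w)" using assms(3) by blast
  have "cylinder ?S (v @ w) \<noteq> {}" "cylinder ?S u \<noteq> {}" "cylinder ?S w \<noteq> {}"
    using cylinder_append_right[OF x] cylinder_append_left[OF x]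
      cylinder_append_right[OF cylinder_append_right[OF x]] by blast+
  with bval_append[OF assms(1) order_refl order_refl order_refl assms(3)]
    bval_append[OF assms(1) order_refl assms(2) order_refl, of v w] assms(4)
  show ?thesis by fastforce
qed

lemma bval_change_space:
  assumes "distortion_bound I A f M" "X \<subseteq> shift_space I A" "cylinder X w \<noteq> {}"
  shows "\<bar>bval X f w - bval (shift_space I A) f w\<bar> \<le> M"
proof -
  obtain x where x: "x \<in> cylinder X w" using assms(3) by blast
  then have x': "x \<in> cylinder (shift_space I A) w" using assms(2) by (auto simp: cylinder_def)
  show ?thesis
    using birkhoff_sup_bounds(2,3)[OF assms(1,2) x]
      birkhoff_sup_bounds(2,3)[OF assms(1) order_refl x'] by linarith
qed

subsection \<open>The pressure in terms of finite partition sums\<close>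

text \<open>Nonemptiness of the cylinder is imposed explicitly because \<open>bval\<close> would
  report 0 for a word whose true value is minus infinity and which belongs to no window.\<close>

definition word_window ::
  "real \<Rightarrow> (nat \<Rightarrow> nat) set \<Rightarrow> ((nat \<Rightarrow> nat) \<Rightarrow> real) \<Rightarrow> nat list set \<Rightarrow> real \<Rightarrow> nat list set" where
  "word_window \<eta> X \<psi> C T =
     {w \<in> C. cylinder X w \<noteq> {} \<and> T - \<eta> < bval X \<psi> w \<and> bval X \<psi> w \<le> T}"

lemma word_window_eq:
  assumes "distortion_bound I A \<psi> M" "X \<subseteq> shift_space I A"
  shows "{w \<in> C. ereal (T - \<eta>) < birkhoff_sup X \<psi> w \<and> birkhoff_sup X \<psi> w \<le> ereal T}
    = word_window \<eta> X \<psi> C T"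
proof -
  have "ereal (T - \<eta>) < birkhoff_sup X \<psi> w \<and> birkhoff_sup X \<psi> w \<le> ereal T \<longleftrightarrow>
      cylinder X w \<noteq> {} \<and> T - \<eta> < bval X \<psi> w \<and> bval X \<psi> w \<le> T" for w
  proof (cases "cylinder X w = {}")
    case True
    then show ?thesis by (simp add: birkhoff_sup_def bot_ereal_def)
  next
    case False
    then obtain x where "x \<in> cylinder X w" by blast
    from birkhoff_sup_bounds(1)[OF assms this] False show ?thesis by simp
  qed
  then show ?thesis by (auto simp: word_window_def)
qed

text \<open>A sum in \<open>[0, \<infinity>]\<close> is the supremum of its finite partial sums, so
  bounding it amounts to bounding real sums over all finite parts of the window.\<close>

lemma partition_sum_le_iff:
  assumes "distortion_bound I A \<psi> M" "distortion_bound I A \<phi> M'" "X \<subseteq> shift_space I A" "B \<ge> 0"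
  shows "(\<Sum>\<^sub>\<infinity> w \<in> {w \<in> C. ereal (T - \<eta>) < birkhoff_sup X \<psi> w \<and> birkhoff_sup X \<psi> w \<le> ereal T}.
            exp_ereal (birkhoff_sup X \<phi> w)) \<le> ennreal B
    \<longleftrightarrow> (\<forall>F. finite F \<longrightarrow> F \<subseteq> word_window \<eta> X \<psi> C T \<longrightarrow> (\<Sum>w\<in>F. exp (bval X \<phi> w)) \<le> B)"
proof -
  let ?W = "word_window \<eta> X \<psi> C T"
  have sum_eq: "(\<Sum>w\<in>F. exp_ereal (birkhoff_sup X \<phi> w)) = ennreal (\<Sum>w\<in>F. exp (bval X \<phi> w))"
    if "F \<subseteq> ?W" for F
  proof -
    have "exp_ereal (birkhoff_sup X \<phi> w) = ennreal (exp (bval X \<phi> w))" if w: "w \<in> F" for w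
    proof -
      obtain x where "x \<in> cylinder X w" using w \<open>F \<subseteq> ?W\<close> unfolding word_window_def by blast
      from birkhoff_sup_bounds(1)[OF assms(2,3) this] show ?thesis by (simp add: exp_ereal_def)
    qed
    then show ?thesis by simp
  qed
  have "(\<Sum>\<^sub>\<infinity>w\<in>?W. exp_ereal (birkhoff_sup X \<phi> w))
      = (SUP F\<in>{F. finite F \<and> F \<subseteq> ?W}. \<Sum>w\<in>F. exp_ereal (birkhoff_sup X \<phi> w))"
    by (rule nonneg_infsum_complete) auto
  then show ?thesis
    unfolding word_window_eq[OF assms(1,3)] using sum_eq assms(4)
    by (auto simp: SUP_le_iff sum_nonneg)
qed

lemma ln_ennreal_scaled_le_iff:
  assumes "T > 0"
  shows "ereal (1 / T) * ln_ennreal x \<le> ereal l \<longleftrightarrow> x \<le> ennreal (exp (l * T))"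
proof (cases x)
  case top
  then show ?thesis using assms by (simp add: ln_ennreal_def top_unique)
next
  case (real r)
  show ?thesis
  proof (cases "r = 0")
    case True
    then show ?thesis using real assms by (simp add: ln_ennreal_def)
  next
    case False
    then have r: "r > 0" using real by simp
    then have "ereal (1 / T) * ln_ennreal x \<le> ereal l \<longleftrightarrow> ln r / T \<le> l"
      using real by (simp add: ln_ennreal_def)
    also have "\<dots> \<longleftrightarrow> ln r \<le> l * T" using assms by (simp add: field_simps)
    also have "\<dots> \<longleftrightarrow> r \<le> exp (l * T)" using r exp_le_cancel_iff[of "ln r" "l * T"] by simp
    also have "\<dots> \<longleftrightarrow> x \<le> ennreal (exp (l * T))" using real by simp
    finally show ?thesis .
  qed
qed

text \<open>Together with \<open>induced_pressure_leI\<close> this trades the limsup for estimates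
  of finite sums; strictness of the inequality yields a bound for all large
  \<open>T\<close>.\<close>

lemma induced_pressure_lessD:
  assumes "distortion_bound I A \<psi> M" "distortion_bound I A \<phi> M'" "X \<subseteq> shift_space I A"
    and "induced_pressure \<eta> X \<psi> \<phi> C < ereal l"
  shows "\<exists>T\<^sub>0. \<forall>T\<ge>T\<^sub>0. \<forall>F. finite F \<longrightarrow> F \<subseteq> word_window \<eta> X \<psi> C T \<longrightarrow>
    (\<Sum>w\<in>F. exp (bval X \<phi> w)) \<le> exp (l * T)"
proof -
  have "\<forall>\<^sub>F T in at_top. ereal (1 / T) *
       ln_ennreal (\<Sum>\<^sub>\<infinity> w \<in> {w \<in> C. ereal (T - \<eta>) < birkhoff_sup X \<psi> w
                                      \<and> birkhoff_sup X \<psi> w \<le> ereal T}.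
                     exp_ereal (birkhoff_sup X \<phi> w)) < ereal l"
    using Limsup_lessD[OF assms(4)[unfolded induced_pressure_def]] .
  then have "\<forall>\<^sub>F T in at_top. \<forall>F. finite F \<longrightarrow> F \<subseteq> word_window \<eta> X \<psi> C T \<longrightarrow>
    (\<Sum>w\<in>F. exp (bval X \<phi> w)) \<le> exp (l * T)"
    using eventually_gt_at_top[of "0::real"]
    by eventually_elim
      (subst partition_sum_le_iff[OF assms(1-3), symmetric], simp,
       simp flip: ln_ennreal_scaled_le_iff add: less_imp_le)
  then show ?thesis by (simp add: eventually_at_top_linorder)
qed

lemma induced_pressure_leI:
  assumes "distortion_bound I A \<psi> M" "distortion_bound I A \<phi> M'" "X \<subseteq> shift_space I A"
    and "\<And>T F. \<lbrakk>T \<ge> T\<^sub>0; finite F; F \<subseteq> word_window \<eta> X \<psi> C T\<rbrakk>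
      \<Longrightarrow> (\<Sum>w\<in>F. exp (bval X \<phi> w)) \<le> exp (l * T)"
  shows "induced_pressure \<eta> X \<psi> \<phi> C \<le> ereal l"
proof -
  have "\<forall>\<^sub>F T in at_top. ereal (1 / T) *
       ln_ennreal (\<Sum>\<^sub>\<infinity> w \<in> {w \<in> C. ereal (T - \<eta>) < birkhoff_sup X \<psi> w
                                      \<and> birkhoff_sup X \<psi> w \<le> ereal T}.
                     exp_ereal (birkhoff_sup X \<phi> w)) \<le> ereal l"
    using eventually_gt_at_top[of "0::real"] eventually_ge_at_top[of T\<^sub>0]
    by eventually_elim
      (use partition_sum_le_iff[OF assms(1-3)] ln_ennreal_scaled_le_iff assms(4) in simp)
  then show ?thesis unfolding induced_pressure_def by (rule Limsup_bounded)
qed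

lemma induced_pressure_mono:
  assumes "C' \<subseteq> C"
  shows "induced_pressure \<eta> X \<psi> \<phi> C' \<le> induced_pressure \<eta> X \<psi> \<phi> C"
proof -
  \<comment> \<open>Every real upper bound of the larger logarithm bounds the smaller one; this is
    the criterion \<open>ln_ennreal_scaled_le_iff\<close> at \<open>T = 1\<close>.\<close>
  have ln_mono: "ln_ennreal x \<le> ln_ennreal y" if "x \<le> y" for x y
  proof -
    have "ereal (1 / 1) * ln_ennreal x \<le> ereal l" if "ereal (1 / 1) * ln_ennreal y \<le> ereal l" for l
      using that \<open>x \<le> y\<close> order_trans by (subst (asm) ln_ennreal_scaled_le_iff, simp, subst ln_ennreal_scaled_le_iff, simp) blast
    then have "ln_ennreal x \<le> ereal l" if "ln_ennreal y \<le> ereal l" for l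
      using that by (simp flip: one_ereal_def)
    then show ?thesis by (meson ereal_le_real)
  qed
  have "(\<Sum>\<^sub>\<infinity> w \<in> {w \<in> C'. P w}. exp_ereal (birkhoff_sup X \<phi> w))
      \<le> (\<Sum>\<^sub>\<infinity> w \<in> {w \<in> C. P w}. exp_ereal (birkhoff_sup X \<phi> w))" for P
    using assms by (intro infsum_mono_neutral nonneg_summable_on_complete) auto
  then show ?thesis
    unfolding induced_pressure_def
    by (intro Limsup_mono eventually_mono[OF eventually_gt_at_top[of "0::real"]]
        ereal_mult_left_mono ln_mono) auto
qed

section \<open>Sums over windows and over fibres\<close>

text \<open>Distortion spreads words over an interval longer than \<open>\<eta>\<close>, while the
  pressure controls windows of length \<open>\<eta>\<close> only. The interval is cut into such
  windows, and each contributes at most \<open>U\<close>.\<close>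

lemma sum_window_cover:
  fixes g \<beta> :: "'a \<Rightarrow> real"
  assumes "finite F" "\<eta> > 0" "\<And>w. w \<in> F \<Longrightarrow> a \<le> \<beta> w \<and> \<beta> w \<le> b" "a \<le> b"
    and "\<And>w. g w \<ge> 0" "U \<ge> 0"
    and "\<And>T. \<lbrakk>a \<le> T; T \<le> b\<rbrakk> \<Longrightarrow> (\<Sum>w\<in>{w \<in> F. T - \<eta> < \<beta> w \<and> \<beta> w \<le> T}. g w) \<le> U"
  shows "sum g F \<le> ((b - a) / \<eta> + 1) * U"
proof -
  \<comment> \<open>Windows are closed on the right, so they are numbered downwards from
    \<open>b\<close>: number \<open>i\<close> has right end
    \<open>b - real i * \<eta>\<close>.\<close>
  define j where "j w = nat \<lfloor>(b - \<beta> w) / \<eta>\<rfloor>" for w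
  define N where "N = nat \<lfloor>(b - a) / \<eta>\<rfloor>"
  have "j w \<in> {..N}" if "w \<in> F" for w
    using assms(2) assms(3)[OF that] by (auto simp: j_def N_def intro!: nat_mono floor_mono divide_right_mono)
  then have "sum g F = (\<Sum>i\<in>{..N}. sum g {w \<in> F. j w = i})"
    by (intro sum.group[symmetric]) (use assms(1) in auto)
  also have "\<dots> \<le> (\<Sum>i\<in>{..N}. U)"
  proof (rule sum_mono)
    fix i
    show "sum g {w \<in> F. j w = i} \<le> U"
    \<comment> \<open>The right end of a window is known to be at least \<open>a\<close> only if
      some element of \<open>F\<close> lies in it; an empty class contributes 0.\<close>
    proof (cases "{w \<in> F. j w = i} = {}")
      case True
      show ?thesis unfolding True using assms(6) by simp
    next
      case False
      define T where "T = b - real i * \<eta>"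
      have *: "T - \<eta> < \<beta> w \<and> \<beta> w \<le> T" if "w \<in> F" "j w = i" for w
      proof -
        have "(b - \<beta> w) / \<eta> \<ge> 0" using assms(2) assms(3)[OF that(1)] by simp
        then have "real i \<le> (b - \<beta> w) / \<eta>" "(b - \<beta> w) / \<eta> < real i + 1"
          using that(2) unfolding j_def by linarith+
        then show ?thesis using assms(2) by (auto simp: T_def field_simps)
      qed
      from False obtain w where w: "w \<in> F" "j w = i" by blast
      have "T \<le> b" using assms(2) by (simp add: T_def)
      moreover have "a \<le> T" using *[OF w] assms(3)[OF w(1)] by linarith
      ultimately have "(\<Sum>w\<in>{w \<in> F. T - \<eta> < \<beta> w \<and> \<beta> w \<le> T}. g w) \<le> U" by (rule assms(7)[rotated])
      moreover have "sum g {w \<in> F. j w = i} \<le> (\<Sum>w\<in>{w \<in> F. T - \<eta> < \<beta> w \<and> \<beta> w \<le> T}. g w)"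
        using * assms(1,5) by (intro sum_mono2) auto
      ultimately show ?thesis by linarith
    qed
  qed
  also have "\<dots> = (real N + 1) * U" by simp
  also have "\<dots> \<le> ((b - a) / \<eta> + 1) * U"
    using assms(2,4,6) unfolding N_def by (intro mult_right_mono add_right_mono) auto
  finally show ?thesis .
qed

lemma sum_image_fibre_bound:
  fixes g :: "'b \<Rightarrow> real"
  assumes "finite F" "\<And>v. g v \<ge> 0" "\<And>v. real (card {w \<in> F. h w = v}) \<le> m"
  shows "(\<Sum>w\<in>F. g (h w)) \<le> m * (\<Sum>v\<in>h ` F. g v)"
proof -
  have "(\<Sum>w\<in>F. g (h w)) = (\<Sum>v\<in>h ` F. \<Sum>w\<in>{w \<in> F. h w = v}. g (h w))"
    using assms(1) by (rule sum.image_gen)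
  also have "\<dots> = (\<Sum>v\<in>h ` F. real (card {w \<in> F. h w = v}) * g v)" by simp
  also have "\<dots> \<le> (\<Sum>v\<in>h ` F. m * g v)"
    using assms by (intro sum_mono mult_right_mono) auto
  finally show ?thesis by (simp add: sum_distrib_left)
qed

subsection \<open>Finitely irreducible collections\<close>

text \<open>Appending copies of \<open>w\<close> again and again, joined by links from
  \<open>L\<close>, gives nested words of \<open>D\<close> that converge to an infinite word.
  Control of its letters later places it in a set over a finite alphabet; its long prefixes in
  \<open>D\<close> supply the marker.\<close>

lemma irreducible_extension:
  assumes "D \<subseteq> admissible_words I A" "w \<in> D"
    and "\<And>u v. u \<in> D \<Longrightarrow> v \<in> D \<Longrightarrow> \<exists>d\<in>L \<union> {[]}. u @ d @ v \<in> D"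
  obtains x where "x \<in> cylinder (shift_space I A) w" "\<And>i. x i \<in> set w \<union> \<Union>(set ` L)"
    "\<And>n. \<exists>m\<ge>n. map x [0..<m] \<in> D"
proof -
  define e where "e v = v @ (SOME d. d \<in> L \<union> {[]} \<and> v @ d @ w \<in> D) @ w" for v
  define v where "v n = (e ^^ n) w" for n
  have e: "\<exists>d\<in>L \<union> {[]}. e u = u @ d @ w \<and> u @ d @ w \<in> D" if "u \<in> D" for u
    using someI_ex[of "\<lambda>d. d \<in> L \<union> {[]} \<and> u @ d @ w \<in> D"] assms(3)[OF that assms(2)]
    unfolding e_def by blast
  have v0: "v 0 = w" and v_Suc: "v (Suc n) = e (v n)" for n by (simp_all add: v_def)
  have v: "v n \<in> D \<and> set (v n) \<subseteq> set w \<union> \<Union>(set ` L)" for n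
  proof (induction n)
    case 0
    then show ?case using assms(2) by (simp add: v0)
  next
    case (Suc n)
    then show ?case using e[of "v n"] by (auto simp: v_Suc)
  qed
  have w: "w \<noteq> []" using assms(1,2) by (auto simp: admissible_words_def)
  have len: "n < length (v n)" for n
  proof (induction n)
    case 0
    then show ?case using w by (simp add: v0)
  next
    case (Suc n)
    then show ?case using w by (cases w) (auto simp: v_Suc e_def)
  qed
  have pre: "take (length (v n)) (v (n + k)) = v n" for n k
  proof (induction k)
    case (Suc k)
    have "length (v n) \<le> length (v (n + k))"
      by (metis Suc.IH length_take min.cobounded1 min.commute)
    then show ?case using Suc by (simp add: v_Suc e_def)
  qed simp
  \<comment> \<open>The diagonal is well defined by \<open>len\<close>, and by \<open>pre\<close>
    any \<open>v n\<close> longer than \<open>i\<close> has the same letter at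
    \<open>i\<close>.\<close>
  define x where "x i = v i ! i" for i
  have x: "x i = v n ! i" if "i < length (v n)" for i n
  proof (cases "i \<le> n")
    case True
    then show ?thesis using pre[of i "n - i"] len[of i]
      by (metis le_add_diff_inverse nth_take x_def)
  next
    case False
    then show ?thesis using pre[of n "i - n"] that
      by (metis le_add_diff_inverse nat_le_linear nth_take x_def)
  qed
  have letter: "x i \<in> set (v i)" for i using len[of i] by (simp add: x_def)
  have "x \<in> shift_space I A"
    unfolding shift_space_def
  proof (intro CollectI conjI allI)
    fix i
    show "x i \<in> I" using letter[of i] v[of i] assms(1) by (auto simp: admissible_words_def)
    have "v (Suc i) \<in> admissible_words I A" using v assms(1) by blast
    then show "A (x i) (x (Suc i)) = 1"
      using len[of "Suc i"] x[of i "Suc i"] x[of "Suc i" "Suc i"] by (simp add: admissible_words_def)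
  qed
  then have 1: "x \<in> cylinder (shift_space I A) w"
    using x[of _ 0] by (auto simp: cylinder_def v0)
  have 2: "x i \<in> set w \<union> \<Union>(set ` L)" for i using letter v by blast
  have "map x [0..<length (v n)] = v n" for n
    using x by (auto intro: nth_equalityI)
  then have 3: "\<exists>m\<ge>n. map x [0..<m] \<in> D" for n
    using len[of n] v[of n] by (intro exI[of _ "length (v n)"]) auto
  show thesis by (rule that[OF 1 2 3])
qed

section \<open>Compact invariant sets from finite alphabets\<close>

text \<open>By Tychonoff the sequences over \<open>J\<close> are compact in the product topology,
  and admissibility is a closed condition. The identity then carries compactness over to the metric
  topology.\<close>

lemma finite_alphabet_compact_invariant:
  assumes "finite J"
  shows "compact_invariant I A {x \<in> shift_space I A. \<forall>i. x i \<in> J}"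
proof -
  let ?S = "shift_space I A" and ?K = "{x \<in> shift_space I A. \<forall>i. x i \<in> J}"
  interpret Metric_space ?S "shift_dist 1" by (rule Metric_space_shift_dist) simp
  have cont: "continuous_on UNIV (\<lambda>x :: nat \<Rightarrow> nat. x i)" for i
    by (rule continuous_on_product_coordinates)
  have coord_open: "open {x :: nat \<Rightarrow> nat. x i \<in> B}" for i B
    using open_vimage[OF open_discrete cont] by (auto simp: vimage_def)
  have coord_closed: "closed {x :: nat \<Rightarrow> nat. x i \<in> B}" for i B
    using coord_open[of i "- B"] by (simp add: closed_def Compl_eq)
  \<comment> \<open>The condition reads two discrete coordinates, so its complement is a union of
    open sets, one for each forbidden pair.\<close>
  have edge_closed: "closed {x :: nat \<Rightarrow> nat. A (x i) (x (Suc i)) = 1}" for i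
  proof -
    have "- {x :: nat \<Rightarrow> nat. A (x i) (x (Suc i)) = 1} =
        (\<Union>a. \<Union>b\<in>{b. A a b \<noteq> 1}. {x. x i \<in> {a}} \<inter> {x. x (Suc i) \<in> {b}})"
      by auto
    also have "open \<dots>" by (intro open_UN open_Int ballI coord_open)
    finally show ?thesis by (simp add: closed_def)
  qed
  have eq: "?K = (PiE UNIV (\<lambda>_. J)) \<inter> ((\<Inter>i. {x. x i \<in> I}) \<inter> (\<Inter>i. {x. A (x i) (x (Suc i)) = 1}))"
    by (auto simp: shift_space_def PiE_def)
  have "compactin (product_topology (\<lambda>_. euclidean) UNIV) (PiE UNIV (\<lambda>_::nat. J))"
    using assms by (simp add: compactin_PiE finite_imp_compact)
  then have "compact (PiE UNIV (\<lambda>_::nat. J))"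
    by (simp add: euclidean_product_topology)
  then have "compact ?K"
    unfolding eq by (intro compact_Int_closed closed_Int closed_INT ballI coord_closed edge_closed)
  then have "compactin (top_of_set ?S) ?K"
    by (auto simp: compactin_subtopology)
  \<comment> \<open>Every metric ball contains the points of a cylinder around its centre, which
    restricts finitely many coordinates and is open in the product topology.\<close>
  moreover have "continuous_map (top_of_set ?S) (shift_topology I A) id"
    unfolding continuous_map_def
  proof (intro conjI allI impI)
    fix U assume U: "openin (shift_topology I A) U"
    have "\<exists>T. open T \<and> x \<in> T \<and> T \<inter> ?S \<subseteq> U" if "x \<in> U" for x
    proof -
      obtain r where "U \<subseteq> ?S" "r > 0" and r: "mball x r \<subseteq> U"
        using U \<open>x \<in> U\<close> unfolding shift_topology_def openin_mtopology by blast
      have "(\<lambda>n. exp (- 1 * real n)) \<longlonglongrightarrow> 0" by real_asymp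
      then have "eventually (\<lambda>n. exp (- 1 * real n) < r) sequentially"
        using \<open>r > 0\<close> by (rule order_tendstoD)
      then obtain n where n: "exp (- 1 * real n) < r"
        by (meson eventually_happens' sequentially_bot)
      have "(\<Inter>i<Suc n. {y. y i \<in> {x i}}) \<inter> ?S \<subseteq> mball x r"
      proof
        fix y assume y: "y \<in> (\<Inter>i<Suc n. {y. y i \<in> {x i}}) \<inter> ?S"
        then have "shift_dist 1 x y < exp (- 1 * real n)"
          by (subst shift_dist_less_exp_iff) auto
        then show "y \<in> mball x r" using y n \<open>U \<subseteq> ?S\<close> \<open>x \<in> U\<close> by auto
      qed
      moreover have "open (\<Inter>i<Suc n. {y. y i \<in> {x i}})"
        by (intro open_INT ballI coord_open) simp
      ultimately show ?thesis using r by (intro exI[of _ "\<Inter>i<Suc n. {y. y i \<in> {x i}}"]) auto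
    qed
    then obtain O' where O': "\<And>x. x \<in> U \<Longrightarrow> open (O' x) \<and> x \<in> O' x \<and> O' x \<inter> ?S \<subseteq> U"
      by metis
    moreover have US: "U \<subseteq> ?S" using U unfolding shift_topology_def openin_mtopology by blast
    ultimately have "U = ?S \<inter> (\<Union>x\<in>U. O' x)" by blast
    moreover have "open (\<Union>x\<in>U. O' x)" using O' by blast
    ultimately have "openin (top_of_set ?S) U" by (auto simp: openin_open)
    moreover have "{x \<in> topspace (top_of_set ?S). id x \<in> U} = U" using US by auto
    ultimately show "openin (top_of_set ?S) {x \<in> topspace (top_of_set ?S). id x \<in> U}" by simp
  qed (auto simp: shift_topology_def)
  ultimately have "compactin (shift_topology I A) (id ` ?K)" by (rule image_compactin)
  then show ?thesis
    by (auto simp: compact_invariant_def shift_space_def left_shift_def)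
qed

section \<open>The marker word and the decoding of concatenations\<close>

text \<open>Pointwise positivity of \<open>\<psi>\<close> need not give a positive lower bound on
  the whole shift. Near one point \<open>x\<close> it does: on the cylinder of a long prefix of
  \<open>x\<close>, \<open>\<psi>\<close> exceeds \<open>\<psi> x / 2\<close>, and \<open>x\<close>
  can be chosen with long prefixes in \<open>D\<close>.\<close>

lemma exists_heavy_word:
  assumes "holder_continuous I A \<psi>" "\<forall>x\<in>shift_space I A. \<psi> x > 0"
    and "D \<subseteq> admissible_words I A" "D \<noteq> {}"
    and "\<And>u v. u \<in> D \<Longrightarrow> v \<in> D \<Longrightarrow> \<exists>d\<in>L \<union> {[]}. u @ d @ v \<in> D"
  obtains u \<kappa> where "u \<in> D" "\<kappa> > 0" "\<And>x. x \<in> cylinder (shift_space I A) u \<Longrightarrow> \<psi> x \<ge> \<kappa>"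
proof -
  obtain w where "w \<in> D" using assms(4) by blast
  then obtain x where x: "x \<in> cylinder (shift_space I A) w" "\<And>n. \<exists>m\<ge>n. map x [0..<m] \<in> D"
    using irreducible_extension[OF assms(3) _ assms(5)] by metis
  have xS: "x \<in> shift_space I A" using x(1) by (simp add: cylinder_def)
  obtain \<alpha> V where *: "\<alpha> > 0" "V \<ge> 0"
    "\<And>x y n. \<lbrakk>x \<in> shift_space I A; y \<in> shift_space I A; \<forall>i<Suc n. x i = y i\<rbrakk>
       \<Longrightarrow> \<bar>\<psi> x - \<psi> y\<bar> \<le> V * exp (- \<alpha> * real n)"
    using holder_continuousE[OF assms(1)] by blast
  have pos: "\<psi> x > 0" using assms(2) xS by blast
  have "(\<lambda>n. V * exp (- \<alpha> * real n)) \<longlonglongrightarrow> 0"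
    using \<open>\<alpha> > 0\<close> by real_asymp
  then have "eventually (\<lambda>n. V * exp (- \<alpha> * real n) < \<psi> x / 2) sequentially"
    using pos by (intro order_tendstoD) auto
  then obtain n where n: "V * exp (- \<alpha> * real n) < \<psi> x / 2"
    by (meson eventually_happens' sequentially_bot)
  obtain m where m: "m \<ge> Suc n" "map x [0..<m] \<in> D" using x(2) by blast
  have "\<psi> y \<ge> \<psi> x / 2" if "y \<in> cylinder (shift_space I A) (map x [0..<m])" for y
  proof -
    have "y \<in> shift_space I A" "\<forall>i<Suc n. x i = y i"
      using that m(1) by (auto simp: cylinder_def)
    from *(3)[OF xS this] n show ?thesis by linarith
  qed
  then show thesis using that m(2) pos by (meson half_gt_zero)
qed

text \<open>
  The elements of \<open>P\<close> are the possible starting positions, in the word \<open>V\<close>, of a last block taken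
  from the window at \<open>T\<close> and preceded by the marker \<open>u\<close>.
\<close>

lemma card_parsings_le:
  fixes T :: real and D :: "nat list set" and u d V :: "nat list"
  assumes "distortion_bound I A \<psi> M" "\<forall>x\<in>shift_space I A. \<psi> x > 0" "\<eta> > 0"
    and "\<kappa> > 0" "\<And>x. x \<in> cylinder (shift_space I A) u \<Longrightarrow> \<psi> x \<ge> \<kappa>"
    and "cylinder (shift_space I A) V \<noteq> {}" "u \<noteq> []"
  defines "P \<equiv> {c. c \<le> length V \<and> drop c V \<in> word_window \<eta> (shift_space I A) \<psi> D T \<and>
    (\<exists>W. V = W @ u @ d @ drop c V)}"
  shows "real (card P) \<le> real (length u + length d) + (\<eta> + M) / \<kappa>"
proof (cases "P = {}")
  case True
  have "M \<ge> 0" using assms(1) by (simp add: distortion_bound_def)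
  then show ?thesis unfolding True using assms(3,4) by simp
next
  case False
  let ?S = "shift_space I A"
  have fin: "finite P" by (rule finite_subset[of _ "{..length V}"]) (auto simp: P_def)
  obtain \<tau> where \<tau>: "\<tau> \<in> cylinder ?S V" using assms(6) by blast
  have \<tau>S: "\<tau> \<in> ?S" using \<tau> by (simp add: cylinder_def)
  define F where "F k = \<psi> ((left_shift ^^ k) \<tau>)" for k
  have F_pos: "F k > 0" for k
    using assms(2) funpow_left_shift_in_shift_space[OF \<tau>S] by (simp add: F_def)
  \<comment> \<open>All candidate tails are measured along the same orbit \<open>\<tau>\<close>, so
    their sums lie in one interval of length \<open>\<eta> + M\<close>.\<close>
  have tail: "T - \<eta> - M < (\<Sum>k\<in>{c..<length V}. F k) \<and> (\<Sum>k\<in>{c..<length V}. F k) \<le> T"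
    if "c \<in> P" for c
  proof -
    have c: "c \<le> length V" "drop c V \<in> word_window \<eta> ?S \<psi> D T" using that by (auto simp: P_def)
    have "(left_shift ^^ c) \<tau> \<in> cylinder ?S (drop c V)"
      using cylinder_append_right[of \<tau> I A "take c V" "drop c V"] \<tau> c(1) by simp
    from birkhoff_sup_bounds(2,3)[OF assms(1) order_refl this] c(2)
    have "T - \<eta> - M < bsum \<psi> (length V - c) ((left_shift ^^ c) \<tau>)"
      "bsum \<psi> (length V - c) ((left_shift ^^ c) \<tau>) \<le> T"
      by (auto simp: word_window_def)
    moreover have "bsum \<psi> (length V - c) ((left_shift ^^ c) \<tau>) = (\<Sum>k\<in>{c..<length V}. F k)"
    proof -
      have "bsum \<psi> (length V - c) ((left_shift ^^ c) \<tau>) = (\<Sum>k=0..<length V - c. F (k + c))"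
        by (simp add: bsum_def F_def left_shift_funpow add.assoc atLeast0LessThan)
      also have "\<dots> = (\<Sum>k\<in>{c..<length V}. F k)"
        using c(1) sum.shift_bounds_nat_ivl[of F 0 c "length V - c"] by simp
      finally show ?thesis .
    qed
    ultimately show ?thesis by simp
  qed
  define l where "l = length u + length d"
  define a where "a = Min P"
  define b where "b = Max P"
  have ab: "a \<in> P" "b \<in> P" "a \<le> b" using False fin by (auto simp: a_def b_def)
  have bV: "b \<le> length V" using ab(2) by (simp add: P_def)
  \<comment> \<open>Candidates at least \<open>l\<close> beyond the first one: their markers start
    at \<open>c - l\<close>, hence not before \<open>a\<close>. At most \<open>l\<close> candidates
    are left out.\<close>
  define Q where "Q = {c \<in> P. a + l \<le> c}"
  have finQ: "finite Q" using fin by (simp add: Q_def)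
  have heavy: "F (c - l) \<ge> \<kappa>" if c: "c \<in> Q" for c
  proof -
    obtain W where W: "V = W @ u @ d @ drop c V" "c \<le> length V"
      using c unfolding Q_def P_def by blast
    then have "length V = length W + l + (length V - c)"
      by (metis add.assoc length_append length_drop l_def)
    then have "length W = c - l" using W(2) by linarith
    moreover have "(left_shift ^^ length W) \<tau> \<in> cylinder ?S u"
      using \<tau> W(1) by (metis cylinder_append_left cylinder_append_right)
    ultimately show ?thesis using assms(5) by (simp add: F_def)
  qed
  \<comment> \<open>The marker starts are distinct positions between \<open>a\<close> and
    \<open>b\<close>, each worth at least \<open>\<kappa>\<close>, while the orbit sum from
    \<open>a\<close> to \<open>b\<close> is a difference of two tails.\<close>
  have "\<kappa> * real (card Q) \<le> (\<Sum>c\<in>Q. F (c - l))"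
    using sum_mono[of Q "\<lambda>_. \<kappa>" "\<lambda>c. F (c - l)"] heavy by (simp add: mult.commute)
  also have "\<dots> = sum F ((\<lambda>c. c - l) ` Q)"
    by (subst sum.reindex) (auto simp: inj_on_def Q_def)
  also have "\<dots> \<le> sum F {a..<b}"
  proof -
    have l: "l > 0" using assms(7) by (simp add: l_def)
    have "(\<lambda>c. c - l) ` Q \<subseteq> {a..<b}"
    proof
      fix t assume "t \<in> (\<lambda>c. c - l) ` Q"
      then obtain c where c: "c \<in> P" "a + l \<le> c" "t = c - l" by (auto simp: Q_def)
      have "c \<le> b" using c(1) fin by (simp add: b_def)
      then show "t \<in> {a..<b}" using c l by auto
    qed
    then show ?thesis using F_pos by (intro sum_mono2) (auto simp: less_imp_le)
  qed
  also have "sum F {a..<b} = sum F {a..<length V} - sum F {b..<length V}"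
    using sum.atLeastLessThan_concat[OF ab(3) bV, of F] by simp
  also have "\<dots> \<le> \<eta> + M" using tail[OF ab(1)] tail[OF ab(2)] by linarith
  finally have "real (card Q) \<le> (\<eta> + M) / \<kappa>" using assms(4) by (simp add: field_simps)
  moreover have "P \<subseteq> {a..<a + l} \<union> Q" using fin by (auto simp: Q_def a_def)
  then have "card P \<le> l + card Q"
    using card_mono[of "{a..<a + l} \<union> Q" P] card_Un_le[of "{a..<a + l}" Q] finQ by simp
  ultimately show ?thesis by (simp add: l_def)
qed

lemma finite_bounded_abs:
  fixes f :: "'a \<Rightarrow> real"
  assumes "finite G"
  shows "\<exists>B\<ge>0. \<forall>g\<in>G. \<bar>f g\<bar> \<le> B"
proof (intro exI conjI ballI)
  show "0 \<le> (\<Sum>g\<in>G. \<bar>f g\<bar>)" by (simp add: sum_nonneg)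
  show "\<bar>f g\<bar> \<le> (\<Sum>g\<in>G. \<bar>f g\<bar>)" if "g \<in> G" for g
    using member_le_sum[of g G "\<lambda>g. \<bar>f g\<bar>"] assms that by simp
qed

text \<open>Gluing multiplies partition sums up to a factor \<open>q\<close> that depends on neither
  \<open>T\<close>, \<open>W\<close> nor \<open>F\<close>; this uniformity lets the step be iterated
  and \<open>T\<close> be chosen after \<open>q\<close>.\<close>

lemma concatenation_step:
  fixes \<eta> \<kappa> :: real
  assumes \<psi>: "distortion_bound I A \<psi> M" and \<phi>: "distortion_bound I A \<phi> M'"
    and pos: "\<forall>x\<in>shift_space I A. \<psi> x > 0" and \<eta>: "\<eta> > 0"
    and D: "D \<subseteq> admissible_words I A"
    and irr: "\<And>u v. u \<in> D \<Longrightarrow> v \<in> D \<Longrightarrow> \<exists>d\<in>L \<union> {[]}. u @ d @ v \<in> D" and L: "finite L"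
    and u: "u \<in> D" "\<kappa> > 0" "\<And>x. x \<in> cylinder (shift_space I A) u \<Longrightarrow> \<psi> x \<ge> \<kappa>"
  obtains q where "q > 0"
    "\<And>T W F. \<lbrakk>finite W; W \<subseteq> D; finite F; F \<subseteq> word_window \<eta> (shift_space I A) \<psi> D T\<rbrakk> \<Longrightarrow>
      \<exists>V. finite V \<and> V \<subseteq> D \<and>
        (\<forall>v\<in>V. \<exists>w\<in>W. \<exists>d\<in>L \<union> {[]}. \<exists>d'\<in>L \<union> {[]}. \<exists>f\<in>F. v = w @ (d @ u @ d') @ f) \<and>
        q * (\<Sum>w\<in>W. exp (bval (shift_space I A) \<phi> w)) * (\<Sum>f\<in>F. exp (bval (shift_space I A) \<phi> f))
          \<le> (\<Sum>v\<in>V. exp (bval (shift_space I A) \<phi> v))"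
proof -
  let ?S = "shift_space I A"
  define L' where "L' = L \<union> {[]}"
  have L': "finite L'" using L by (simp add: L'_def)
  have une: "u \<noteq> []" using u(1) D by (auto simp: admissible_words_def)
  have ne: "cylinder ?S w \<noteq> {}" if w: "w \<in> D" for w
    by (rule irreducible_extension[OF D w irr]) auto
  obtain B where B: "B \<ge> 0" "\<And>g. g \<in> (\<lambda>(d, d'). d @ u @ d') ` (L' \<times> L') \<Longrightarrow> \<bar>bval ?S \<phi> g\<bar> \<le> B"
    using finite_bounded_abs[of "(\<lambda>(d, d'). d @ u @ d') ` (L' \<times> L')" "bval ?S \<phi>"] L' by blast
  obtain R where R: "R \<ge> 0" "\<And>d. d \<in> L' \<Longrightarrow> \<bar>real (length d)\<bar> \<le> R"
    using finite_bounded_abs[OF L', of "\<lambda>d. real (length d)"] by blast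
  \<comment> \<open>\<open>N\<close> bounds the number of positions at which the last block can
    start once the link before it is known; \<open>m\<close> sums this over all pairs of
    links.\<close>
  define N where "N = real (length u) + R + (\<eta> + M) / \<kappa>"
  define m where "m = real (card (L' \<times> L')) * N"
  have "M \<ge> 0" using \<psi> by (simp add: distortion_bound_def)
  then have "N > 0" using une R(1) \<eta> u(2) by (simp add: N_def add_pos_nonneg)
  moreover have "card (L' \<times> L') > 0" using L' by (auto simp: card_gt_0_iff L'_def)
  ultimately have m: "m > 0" by (simp add: m_def)
  define q where "q = 1 / (exp (8 * M' + B) * m)"
  \<comment> \<open>Irreducibility is applied twice, the second time with the already linked word on
    the left, so that the whole concatenation lies in \<open>D\<close>.\<close>
  have "\<exists>p. fst p \<in> L' \<and> snd p \<in> L' \<and> w @ (fst p @ u @ snd p) @ f \<in> D"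
    if wf: "w \<in> D" "f \<in> D" for w f
  proof -
    obtain d where d: "d \<in> L'" "w @ d @ u \<in> D" using irr[OF wf(1) u(1)] unfolding L'_def by blast
    obtain d' where d': "d' \<in> L'" "(w @ d @ u) @ d' @ f \<in> D"
      using irr[OF d(2) wf(2)] unfolding L'_def by blast
    show ?thesis by (rule exI[of _ "(d, d')"]) (use d d' in simp)
  qed
  then obtain j where j: "fst (j w f) \<in> L' \<and> snd (j w f) \<in> L' \<and>
      w @ (fst (j w f) @ u @ snd (j w f)) @ f \<in> D" if "w \<in> D" "f \<in> D" for w f
    by metis
  show thesis
  proof (rule that[of q])
    show "q > 0" using m by (simp add: q_def)
    fix T W F
    assume W: "finite W" "W \<subseteq> D" and F: "finite F" "F \<subseteq> word_window \<eta> ?S \<psi> D T"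
    have FD: "F \<subseteq> D" using F(2) by (auto simp: word_window_def)
    define h where "h = (\<lambda>(w, f). w @ (fst (j w f) @ u @ snd (j w f)) @ f)"
    let ?e = "\<lambda>w. exp (bval ?S \<phi> w)"
    have fibre: "real (card {p \<in> W \<times> F. h p = v}) \<le> m" for v
    proof (cases "{p \<in> W \<times> F. h p = v} = {}")
      case True
      show ?thesis unfolding True using m by simp
    next
      case False
      then obtain w f where "w \<in> W" "f \<in> F" "v = h (w, f)" by auto
      then have "v \<in> D" using j[of w f] W(2) FD by (auto simp: h_def)
      note vne = ne[OF this]
      define P where "P d = {c. c \<le> length v \<and> drop c v \<in> word_window \<eta> ?S \<psi> D T \<and>
        (\<exists>W. v = W @ u @ d @ drop c v)}" for d
      have finP: "finite (P d)" for d by (rule finite_subset[of _ "{..length v}"]) (auto simp: P_def)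
      have cardP: "real (card (P d)) \<le> N" if "d \<in> L'" for d
        using card_parsings_le[OF \<psi> pos \<eta> u(2,3) vne une, of D T d] R(2)[OF that]
        unfolding P_def N_def by simp
      \<comment> \<open>The links and the starting position of \<open>f\<close> determine the pair:
        the position splits off \<open>f\<close>, and cancelling the links and the marker leaves
        \<open>w\<close>.\<close>
      define k where "k = (\<lambda>(w, f). (j w f, length v - length (f :: nat list)))"
      have "inj_on k {p \<in> W \<times> F. h p = v}"
      proof (rule inj_onI)
        fix p p' assume p: "p \<in> {p \<in> W \<times> F. h p = v}" and p': "p' \<in> {p \<in> W \<times> F. h p = v}"
          and k: "k p = k p'"
        obtain w f where [simp]: "p = (w, f)" by (cases p)
        obtain w' f' where [simp]: "p' = (w', f')" by (cases p')
        have v1: "v = w @ (fst (j w f) @ u @ snd (j w f)) @ f" using p by (auto simp: h_def)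
        have v2: "v = w' @ (fst (j w f) @ u @ snd (j w f)) @ f'"
          using p' k by (auto simp: h_def k_def)
        have "length f \<le> length v" "length f' \<le> length v"
          using arg_cong[OF v1, of length] arg_cong[OF v2, of length] by auto
        then have "length f = length f'" using k by (auto simp: k_def)
        then show "p = p'" using v1 v2 by (simp flip: append_assoc)
      qed
      moreover have "k ` {p \<in> W \<times> F. h p = v} \<subseteq> Sigma (L' \<times> L') (\<lambda>dd. P (snd dd))"
      proof
        fix y assume "y \<in> k ` {p \<in> W \<times> F. h p = v}"
        then obtain w f where wf: "w \<in> W" "f \<in> F" "h (w, f) = v" "y = k (w, f)" by auto
        have v: "v = (w @ fst (j w f)) @ u @ snd (j w f) @ f" using wf(3) by (simp add: h_def)
        then have "length v = length w + length (fst (j w f)) + length u + length (snd (j w f)) + length f"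
          by (metis add.assoc length_append)
        moreover have "f = drop (length v - length f) v"
          by (subst (2) v) (simp add: calculation)
        ultimately have "length v - length f \<in> P (snd (j w f))"
          using v wf(2) F(2) unfolding P_def by (auto intro: exI[of _ "w @ fst (j w f)"])
        moreover have "j w f \<in> L' \<times> L'"
          using j[of w f] wf(1,2) W(2) FD by (metis mem_Times_iff subsetD)
        ultimately show "y \<in> Sigma (L' \<times> L') (\<lambda>dd. P (snd dd))"
          using wf(4) by (simp add: k_def)
      qed
      ultimately have "card {p \<in> W \<times> F. h p = v} \<le> card (Sigma (L' \<times> L') (\<lambda>dd. P (snd dd)))"
        using L' finP by (intro card_inj_on_le) auto
      also have "\<dots> = (\<Sum>dd\<in>L' \<times> L'. card (P (snd dd)))" using L' finP by simp
      finally have "real (card {p \<in> W \<times> F. h p = v}) \<le> real (\<Sum>dd\<in>L' \<times> L'. card (P (snd dd)))"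
        by (simp only: of_nat_le_iff)
      also have "\<dots> = (\<Sum>dd\<in>L' \<times> L'. real (card (P (snd dd))))" by (rule of_nat_sum)
      also have "\<dots> \<le> (\<Sum>dd\<in>L' \<times> L'. N)" by (rule sum_mono, rule cardP) (auto simp only: mem_Times_iff)
      finally show ?thesis by (simp add: m_def)
    qed
    have weight: "?e (fst p) * ?e (snd p) \<le> exp (8 * M' + B) * ?e (h p)" if p: "p \<in> W \<times> F" for p
    proof -
      obtain w f where [simp]: "p = (w, f)" by (cases p)
      have wf: "w \<in> D" "f \<in> D" using p W(2) FD by auto
      let ?g = "fst (j w f) @ u @ snd (j w f)"
      have "\<bar>bval ?S \<phi> ?g\<bar> \<le> B"
        using j[OF wf] by (intro B(2) image_eqI[of _ _ "j w f"]) (auto simp: case_prod_unfold mem_Times_iff)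
      moreover have "\<bar>bval ?S \<phi> (w @ ?g @ f) - bval ?S \<phi> w - bval ?S \<phi> ?g - bval ?S \<phi> f\<bar> \<le> 8 * M'"
        using j[OF wf] wf by (intro bval_append3[OF \<phi>] ne) auto
      ultimately show ?thesis by (simp add: h_def flip: exp_add)
    qed
    have "(\<Sum>w\<in>W. ?e w) * (\<Sum>f\<in>F. ?e f) = (\<Sum>p\<in>W \<times> F. ?e (fst p) * ?e (snd p))"
      by (simp add: sum_product sum.cartesian_product case_prod_unfold)
    also have "\<dots> \<le> (\<Sum>p\<in>W \<times> F. exp (8 * M' + B) * ?e (h p))" by (intro sum_mono weight)
    also have "\<dots> = exp (8 * M' + B) * (\<Sum>p\<in>W \<times> F. ?e (h p))" by (simp add: sum_distrib_left)
    also have "\<dots> \<le> exp (8 * M' + B) * (m * (\<Sum>v\<in>h ` (W \<times> F). ?e v))"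
      using W(1) F(1) fibre by (intro mult_left_mono sum_image_fibre_bound) auto
    finally have "q * (\<Sum>w\<in>W. ?e w) * (\<Sum>f\<in>F. ?e f) \<le> (\<Sum>v\<in>h ` (W \<times> F). ?e v)"
      using m by (simp add: q_def field_simps)
    moreover have "h ` (W \<times> F) \<subseteq> D" using j W(2) FD by (auto simp: h_def subset_iff)
    moreover have "\<forall>v\<in>h ` (W \<times> F). \<exists>w\<in>W. \<exists>d\<in>L \<union> {[]}. \<exists>d'\<in>L \<union> {[]}. \<exists>f\<in>F. v = w @ (d @ u @ d') @ f"
    proof
      fix v assume "v \<in> h ` (W \<times> F)"
      then obtain w f where wf: "w \<in> W" "f \<in> F" "v = w @ (fst (j w f) @ u @ snd (j w f)) @ f"
        by (auto simp: h_def)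
      then have "fst (j w f) \<in> L \<union> {[]}" "snd (j w f) \<in> L \<union> {[]}"
        using j[of w f] W(2) FD unfolding L'_def by blast+
      with wf show "\<exists>w\<in>W. \<exists>d\<in>L \<union> {[]}. \<exists>d'\<in>L \<union> {[]}. \<exists>f\<in>F. v = w @ (d @ u @ d') @ f" by blast
    qed
    ultimately show "\<exists>V. finite V \<and> V \<subseteq> D \<and>
        (\<forall>v\<in>V. \<exists>w\<in>W. \<exists>d\<in>L \<union> {[]}. \<exists>d'\<in>L \<union> {[]}. \<exists>f\<in>F. v = w @ (d @ u @ d') @ f) \<and>
        q * (\<Sum>w\<in>W. ?e w) * (\<Sum>f\<in>F. ?e f) \<le> (\<Sum>v\<in>V. ?e v)"
      using W(1) F(1) by (intro exI[of _ "h ` (W \<times> F)"] conjI finite_imageI finite_cartesian_product)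
  qed
qed

subsection \<open>Comparison with compact invariant sets\<close>

text \<open>Two reals \<open>l < l'\<close> are placed between the pressures. Padding, multiplicity
  and the number of windows cost a factor independent of \<open>T\<close>, which the gap
  \<open>l' - l\<close> absorbs.\<close>

lemma restricted_pressure_le:
  assumes \<psi>: "distortion_bound I A \<psi> M" and \<phi>: "distortion_bound I A \<phi> M'" and \<eta>: "\<eta> > 0"
    and D: "D \<subseteq> admissible_words I A" "finitely_irreducible I A D"
    and K: "K \<subseteq> shift_space I A" "finitely_embeddable I A (C \<inter> words_meeting I A K) D"
  shows "restricted_pressure I A \<eta> K \<psi> \<phi> C \<le> induced_pressure \<eta> (shift_space I A) \<psi> \<phi> D"
proof (rule ccontr)
  let ?S = "shift_space I A" and ?E = "C \<inter> words_meeting I A K"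
  let ?p = "induced_pressure \<eta> (shift_space I A) \<psi> \<phi> D"
  assume "\<not> restricted_pressure I A \<eta> K \<psi> \<phi> C \<le> ?p"
  then obtain l' where l': "?p < ereal l'" "ereal l' < induced_pressure \<eta> K \<psi> \<phi> ?E"
    unfolding restricted_pressure_def not_le using ereal_dense2 by blast
  then obtain l where l: "?p < ereal l" "l < l'"
    using ereal_dense2[OF l'(1)] by auto
  obtain T0 where T0: "\<And>T F. \<lbrakk>T \<ge> T0; finite F; F \<subseteq> word_window \<eta> ?S \<psi> D T\<rbrakk>
      \<Longrightarrow> (\<Sum>w\<in>F. exp (bval ?S \<phi> w)) \<le> exp (l * T)"
    using induced_pressure_lessD[OF \<psi> \<phi> order_refl l(1)] by blast
  obtain L0 where irr: "\<And>u v. u \<in> D \<Longrightarrow> v \<in> D \<Longrightarrow> \<exists>d\<in>L0 \<union> {[]}. u @ d @ v \<in> D"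
    using D(2) unfolding finitely_irreducible_def by metis
  have ne: "cylinder ?S w \<noteq> {}" if w: "w \<in> D" for w
    by (rule irreducible_extension[OF D(1) w irr]) auto
  obtain L where L: "finite L" "\<And>w. w \<in> ?E \<Longrightarrow> \<exists>t\<in>L. \<exists>t'\<in>L. t @ w @ t' \<in> D"
    using K(2) unfolding finitely_embeddable_def by metis
  obtain t t' where t: "t w \<in> L \<and> t' w \<in> L \<and> t w @ w @ t' w \<in> D" if "w \<in> ?E" for w
    using L(2) by metis
  define h where "h w = t w @ w @ t' w" for w
  obtain B where B: "B \<ge> 0" "\<And>w. w \<in> L \<Longrightarrow> \<bar>bval ?S \<psi> w\<bar> \<le> B"
    using finite_bounded_abs[OF L(1), of "bval ?S \<psi>"] by blast
  obtain B' where B': "B' \<ge> 0" "\<And>w. w \<in> L \<Longrightarrow> \<bar>bval ?S \<phi> w\<bar> \<le> B'"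
    using finite_bounded_abs[OF L(1), of "bval ?S \<phi>"] by blast
  \<comment> \<open>The distortion of a threefold concatenation, plus \<open>B\<close> for each of
    the two padding words.\<close>
  define R where "R = 8 * M + 2 * B"
  define R' where "R' = 8 * M' + 2 * B'"
  have R: "R \<ge> 0" using \<psi> B(1) by (simp add: R_def distortion_bound_def)
  have near: "\<bar>bval ?S \<psi> (h w) - bval K \<psi> w\<bar> \<le> R" "\<bar>bval ?S \<phi> (h w) - bval K \<phi> w\<bar> \<le> R'"
    if w: "w \<in> ?E" "cylinder K w \<noteq> {}" for w
  proof -
    have "cylinder ?S (t w @ w @ t' w) \<noteq> {}" using t[OF w(1)] ne by blast
    note mid = bval_mid[OF \<psi> K(1) this w(2)] bval_mid[OF \<phi> K(1) this w(2)]
    show "\<bar>bval ?S \<psi> (h w) - bval K \<psi> w\<bar> \<le> R" "\<bar>bval ?S \<phi> (h w) - bval K \<phi> w\<bar> \<le> R'"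
      using mid B(2)[of "t w"] B(2)[of "t' w"] B'(2)[of "t w"] B'(2)[of "t' w"] t[OF w(1)]
      unfolding h_def R_def R'_def by linarith+
  qed
  define m where "m = real (card (L \<times> L))"
  \<comment> \<open>The collected constant factors of the estimate below; the added 1 keeps
    \<open>c\<close> positive, so that \<open>ln c\<close> is meaningful.\<close>
  define c where "c = exp R' * (m * (((\<eta> + 2 * R) / \<eta> + 1) * exp (\<bar>l\<bar> * (\<eta> + R)))) + 1"
  have c: "c > 0" using \<eta> R by (simp add: c_def m_def add_nonneg_pos)
  \<comment> \<open>The first threshold puts every window met by the padded words beyond
    \<open>T0\<close>; the second gives \<open>c * exp (l * T) \<le> exp (l' * T)\<close>.\<close>
  have main: "(\<Sum>w\<in>F. exp (bval K \<phi> w)) \<le> exp (l' * T)"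
    if T: "T \<ge> max (T0 + \<eta> + R) (ln c / (l' - l))" and F: "finite F" "F \<subseteq> word_window \<eta> K \<psi> ?E T" for T F
  proof -
    have FE: "w \<in> ?E" "cylinder K w \<noteq> {}" "T - \<eta> < bval K \<psi> w" "bval K \<psi> w \<le> T" if "w \<in> F" for w
      using F(2) that by (auto simp: word_window_def)
    have fibre: "real (card {w \<in> F. h w = v}) \<le> m" for v
    proof -
      have "inj_on (\<lambda>w. (t w, t' w)) {w \<in> F. h w = v}"
      proof (rule inj_onI)
        fix a b assume ab: "a \<in> {w \<in> F. h w = v}" "b \<in> {w \<in> F. h w = v}"
          and eq: "(t a, t' a) = (t b, t' b)"
        then have "h a = h b" by simp
        then show "a = b" using eq by (simp add: h_def)
      qed
      moreover have "(\<lambda>w. (t w, t' w)) ` {w \<in> F. h w = v} \<subseteq> L \<times> L" using FE(1) t by blast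
      ultimately show ?thesis unfolding m_def of_nat_le_iff
        using L(1) by (intro card_inj_on_le[of "\<lambda>w. (t w, t' w)"]) auto
    qed
    have hF: "T - \<eta> - R \<le> bval ?S \<psi> v \<and> bval ?S \<psi> v \<le> T + R" if v: "v \<in> h ` F" for v
    proof -
      obtain w where w: "w \<in> F" "v = h w" using v by blast
      show ?thesis using near(1)[OF FE(1,2)[OF w(1)]] FE(3,4)[OF w(1)] w(2) by auto
    qed
    have window: "(\<Sum>v\<in>{v \<in> h ` F. s - \<eta> < bval ?S \<psi> v \<and> bval ?S \<psi> v \<le> s}. exp (bval ?S \<phi> v))
        \<le> exp (l * T) * exp (\<bar>l\<bar> * (\<eta> + R))" if s: "T - \<eta> - R \<le> s" "s \<le> T + R" for s
    proof -
      have "{v \<in> h ` F. s - \<eta> < bval ?S \<psi> v \<and> bval ?S \<psi> v \<le> s} \<subseteq> word_window \<eta> ?S \<psi> D s"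
        using t FE(1) ne by (auto simp: word_window_def h_def)
      then have "(\<Sum>v\<in>{v \<in> h ` F. s - \<eta> < bval ?S \<psi> v \<and> bval ?S \<psi> v \<le> s}. exp (bval ?S \<phi> v)) \<le> exp (l * s)"
        using T s F(1) by (intro T0) auto
      also have "l * (s - T) \<le> \<bar>l\<bar> * (\<eta> + R)"
      proof -
        have "\<bar>s - T\<bar> \<le> \<eta> + R" using s \<eta> by linarith
        then have "\<bar>l * (s - T)\<bar> \<le> \<bar>l\<bar> * (\<eta> + R)" by (simp add: abs_mult mult_left_mono)
        then show ?thesis by linarith
      qed
      then have "exp (l * s) \<le> exp (l * T) * exp (\<bar>l\<bar> * (\<eta> + R))"
        by (simp add: algebra_simps flip: exp_add)
      finally show ?thesis .
    qed
    have "(\<Sum>w\<in>F. exp (bval K \<phi> w)) \<le> (\<Sum>w\<in>F. exp R' * exp (bval ?S \<phi> (h w)))"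
    proof (rule sum_mono)
      fix w assume "w \<in> F"
      from near(2)[OF FE(1,2)[OF this]]
      show "exp (bval K \<phi> w) \<le> exp R' * exp (bval ?S \<phi> (h w))" by (simp flip: exp_add)
    qed
    also have "\<dots> = exp R' * (\<Sum>w\<in>F. exp (bval ?S \<phi> (h w)))" by (simp add: sum_distrib_left)
    also have "\<dots> \<le> exp R' * (m * (\<Sum>v\<in>h ` F. exp (bval ?S \<phi> v)))"
      using F(1) fibre by (intro mult_left_mono sum_image_fibre_bound) auto
    also have "(\<Sum>v\<in>h ` F. exp (bval ?S \<phi> v))
        \<le> ((T + R - (T - \<eta> - R)) / \<eta> + 1) * (exp (l * T) * exp (\<bar>l\<bar> * (\<eta> + R)))"
      using F(1) \<eta> R hF window by (intro sum_window_cover[where \<beta> = "bval ?S \<psi>"]) auto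
    also have "exp R' * (m * (((T + R - (T - \<eta> - R)) / \<eta> + 1) * (exp (l * T) * exp (\<bar>l\<bar> * (\<eta> + R)))))
        = (c - 1) * exp (l * T)"
      by (simp add: c_def algebra_simps)
    also have "\<dots> \<le> c * exp (l * T)" by simp
    also have "\<dots> = exp (ln c + l * T)" using c by (simp add: exp_add)
    also have "ln c + l * T \<le> l' * T" using T l(2) by (simp add: field_simps)
    finally show ?thesis by (simp add: m_def mult_left_mono)
  qed
  have "induced_pressure \<eta> K \<psi> \<phi> ?E \<le> ereal l'"
    by (rule induced_pressure_leI[OF \<psi> \<phi> K(1) main])
  with l'(2) show False by simp
qed

section \<open>Lower bound by concatenation over a finite alphabet\<close>

text \<open>One finite part \<open>F\<close> of a window at \<open>T\<close>, of mass
  \<open>Z > exp (l' * T)\<close>, generates words of \<open>\<psi>\<close>-value about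
  \<open>Suc n * T\<close> and total mass at least \<open>q ^ n * Z ^ Suc n\<close>. For large
  \<open>T\<close> the loss per block is small against \<open>T\<close>, so the growth rate stays
  above \<open>l\<close>.\<close>

lemma finite_alphabet_pressure_ge:
  assumes \<psi>H: "holder_continuous I A \<psi>" and \<phi>H: "holder_continuous I A \<phi>"
    and pos: "\<forall>x\<in>shift_space I A. \<psi> x > 0" and \<eta>: "\<eta> > 0"
    and D: "D \<subseteq> admissible_words I A" "finitely_irreducible I A D"
    and l: "ereal l < induced_pressure \<eta> (shift_space I A) \<psi> \<phi> D"
  shows "\<exists>K. compact_invariant I A K \<and> ereal l \<le> restricted_pressure I A \<eta> K \<psi> \<phi> D"
proof -
  let ?S = "shift_space I A"
  obtain M where \<psi>: "distortion_bound I A \<psi> M" using holder_distortion_bound[OF \<psi>H] .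
  obtain M' where \<phi>: "distortion_bound I A \<phi> M'" using holder_distortion_bound[OF \<phi>H] .
  have M: "M \<ge> 0" using \<psi> by (simp add: distortion_bound_def)
  obtain l' where l': "l < l'" "ereal l' < induced_pressure \<eta> ?S \<psi> \<phi> D"
    using ereal_dense2[OF l] by auto
  have large: "\<exists>T\<ge>T0. \<exists>F. finite F \<and> F \<subseteq> word_window \<eta> ?S \<psi> D T \<and>
      exp (l' * T) < (\<Sum>w\<in>F. exp (bval ?S \<phi> w))" for T0
  proof (rule ccontr)
    assume "\<not> ?thesis"
    then have "(\<Sum>w\<in>F. exp (bval ?S \<phi> w)) \<le> exp (l' * T)"
      if "T \<ge> T0" "finite F" "F \<subseteq> word_window \<eta> ?S \<psi> D T" for T F
      using that not_le by blast
    then have "induced_pressure \<eta> ?S \<psi> \<phi> D \<le> ereal l'"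
      by (rule induced_pressure_leI[OF \<psi> \<phi> order_refl])
    with l'(2) show False by simp
  qed
  have "D \<noteq> {}"
  proof
    assume "D = {}"
    moreover obtain T F where "F \<subseteq> word_window \<eta> ?S \<psi> D T" "exp (l' * T) < (\<Sum>w\<in>F. exp (bval ?S \<phi> w))"
      using large by blast
    ultimately have "exp (l' * T) < 0" by (auto simp: word_window_def)
    then show False by simp
  qed
  obtain L where L: "finite L" and irr: "\<And>u v. u \<in> D \<Longrightarrow> v \<in> D \<Longrightarrow> \<exists>d\<in>L \<union> {[]}. u @ d @ v \<in> D"
    using D(2) unfolding finitely_irreducible_def by metis
  have ne: "cylinder ?S w \<noteq> {}" if w: "w \<in> D" for w
    by (rule irreducible_extension[OF D(1) w irr]) auto
  obtain u \<kappa> where u: "u \<in> D" "\<kappa> > 0" "\<And>x. x \<in> cylinder ?S u \<Longrightarrow> \<psi> x \<ge> \<kappa>"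
    by (rule exists_heavy_word[OF \<psi>H pos D(1) \<open>D \<noteq> {}\<close> irr]; (assumption | (rule that; assumption)))
  obtain q where q: "q > 0"
    "\<And>T W F. \<lbrakk>finite W; W \<subseteq> D; finite F; F \<subseteq> word_window \<eta> ?S \<psi> D T\<rbrakk> \<Longrightarrow>
      \<exists>V. finite V \<and> V \<subseteq> D \<and>
        (\<forall>v\<in>V. \<exists>w\<in>W. \<exists>d\<in>L \<union> {[]}. \<exists>d'\<in>L \<union> {[]}. \<exists>f\<in>F. v = w @ (d @ u @ d') @ f) \<and>
        q * (\<Sum>w\<in>W. exp (bval ?S \<phi> w)) * (\<Sum>f\<in>F. exp (bval ?S \<phi> f))
          \<le> (\<Sum>v\<in>V. exp (bval ?S \<phi> v))"
    by (rule concatenation_step[OF \<psi> \<phi> pos \<eta> D(1) irr L u]; (assumption | (rule that; assumption)))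
  obtain B where B: "B \<ge> 0"
    "\<forall>p\<in>(L \<union> {[]}) \<times> (L \<union> {[]}). \<bar>bval ?S \<psi> (fst p @ u @ snd p)\<bar> \<le> B"
    using finite_bounded_abs[of "(L \<union> {[]}) \<times> (L \<union> {[]})" "\<lambda>p. bval ?S \<psi> (fst p @ u @ snd p)"] L
    by blast
  \<comment> \<open>Deviation from \<open>T\<close> per block: distortion of the gluing, the linked
    marker, and the width of the window. \<open>R'\<close> adds the cost of passing from the full
    shift to \<open>K\<close>.\<close>
  define R where "R = 8 * M + B + \<eta>"
  define R' where "R' = R + M"
  have R: "R \<ge> 0" "R' > 0" using M B(1) \<eta> by (auto simp: R_def R'_def)
  \<comment> \<open>\<open>T\<close> is fixed before the number of blocks. Its excess
    \<open>(l' - l) * T\<close> pays per block for the gluing (\<open>\<bar>ln q\<bar>\<close>), for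
    the spread of \<open>\<psi>\<close>-values (\<open>\<bar>l\<bar> * R'\<close>) and for counting
    windows (1).\<close>
  obtain T F where T: "T \<ge> max (R' + 1) ((\<bar>ln q\<bar> + \<bar>l\<bar> * R' + 1) / (l' - l))"
    and F: "finite F" "F \<subseteq> word_window \<eta> ?S \<psi> D T"
    and Z: "exp (l' * T) < (\<Sum>w\<in>F. exp (bval ?S \<phi> w))"
    using large by blast
  define Z where "Z = (\<Sum>w\<in>F. exp (bval ?S \<phi> w))"
  have Fw: "f \<in> D \<and> \<bar>bval ?S \<psi> f - T\<bar> \<le> \<eta>" if "f \<in> F" for f
    using F(2) that \<eta> by (auto simp: word_window_def)
  \<comment> \<open>The letters of \<open>L\<close> are included so that
    \<open>irreducible_extension\<close> stays inside the alphabet and yields a point of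
    \<open>K\<close> in each cylinder.\<close>
  define J where "J = \<Union>(set ` F) \<union> \<Union>(set ` L) \<union> set u"
  have finJ: "finite J" using F(1) L by (simp add: J_def)
  define K where "K = {x \<in> ?S. \<forall>i. x i \<in> J}"
  have K: "compact_invariant I A K" "K \<subseteq> ?S"
    unfolding K_def by (rule finite_alphabet_compact_invariant[OF finJ]) auto
  have neK: "cylinder K w \<noteq> {}" if w: "w \<in> D" "set w \<subseteq> J" for w
  proof -
    obtain x where x: "x \<in> cylinder ?S w" "\<And>i. x i \<in> set w \<union> \<Union>(set ` L)"
      by (rule irreducible_extension[OF D(1) w(1) irr]) auto
    have "x i \<in> J" for i using x(2)[of i] w(2) by (auto simp: J_def)
    then show ?thesis using x(1) by (auto simp: cylinder_def K_def)
  qed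
  \<comment> \<open>\<open>Suc n\<close> blocks are joined by \<open>n\<close> gluings, hence the
    exponents of \<open>Z\<close> and \<open>q\<close>.\<close>
  have iter: "\<exists>W. finite W \<and> W \<subseteq> D \<and>
      (\<forall>w\<in>W. set w \<subseteq> J \<and> \<bar>bval ?S \<psi> w - real (Suc n) * T\<bar> \<le> real (Suc n) * R) \<and>
      q ^ n * Z ^ Suc n \<le> (\<Sum>w\<in>W. exp (bval ?S \<phi> w))" for n
  proof (induction n)
    case 0
    have "set f \<subseteq> J \<and> \<bar>bval ?S \<psi> f - T\<bar> \<le> R" if "f \<in> F" for f
      using Fw[OF that] that M B(1) by (auto simp: J_def R_def)
    then show ?case using F(1) Fw by (intro exI[of _ F]) (auto simp: Z_def)
  next
    case (Suc n)
    then obtain W where W: "finite W" "W \<subseteq> D"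
      "\<And>w. w \<in> W \<Longrightarrow> set w \<subseteq> J \<and> \<bar>bval ?S \<psi> w - real (Suc n) * T\<bar> \<le> real (Suc n) * R"
      "q ^ n * Z ^ Suc n \<le> (\<Sum>w\<in>W. exp (bval ?S \<phi> w))" by blast
    obtain V where V: "finite V" "V \<subseteq> D"
      "\<forall>v\<in>V. \<exists>w\<in>W. \<exists>d\<in>L \<union> {[]}. \<exists>d'\<in>L \<union> {[]}. \<exists>f\<in>F. v = w @ (d @ u @ d') @ f"
      "q * (\<Sum>w\<in>W. exp (bval ?S \<phi> w)) * Z \<le> (\<Sum>v\<in>V. exp (bval ?S \<phi> v))"
      using q(2)[OF W(1,2) F, folded Z_def] by (elim exE conjE) (rule that)
    have "set v \<subseteq> J \<and> \<bar>bval ?S \<psi> v - real (Suc (Suc n)) * T\<bar> \<le> real (Suc (Suc n)) * R" if v: "v \<in> V" for v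
    proof -
      obtain w d d' f where w: "w \<in> W" "d \<in> L \<union> {[]}" "d' \<in> L \<union> {[]}" "f \<in> F" "v = w @ (d @ u @ d') @ f"
        using bspec[OF V(3) v] by blast
      have "set d \<subseteq> J" "set d' \<subseteq> J" using w(2,3) by (auto simp: J_def)
      then have "set v \<subseteq> J" using W(3)[OF w(1)] w(4,5) by (auto simp: J_def)
      moreover have "\<bar>bval ?S \<psi> v - bval ?S \<psi> w - bval ?S \<psi> (d @ u @ d') - bval ?S \<psi> f\<bar> \<le> 8 * M"
        unfolding w(5) using V(2) v W(2) w Fw by (intro bval_append3[OF \<psi>] order_refl ne) auto
      moreover have "\<bar>bval ?S \<psi> w - real (Suc n) * T\<bar> \<le> real (Suc n) * R" using W(3)[OF w(1)] by blast
      moreover have "\<bar>bval ?S \<psi> (d @ u @ d')\<bar> \<le> B"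
        using bspec[OF B(2) SigmaI[OF w(2,3)]] by simp
      moreover have "\<bar>bval ?S \<psi> f - T\<bar> \<le> \<eta>" using Fw w(4) by blast
      moreover have "real (Suc (Suc n)) * T = real (Suc n) * T + T"
        "real (Suc (Suc n)) * R = real (Suc n) * R + R" by (simp_all add: algebra_simps)
      ultimately show ?thesis unfolding R_def by linarith
    qed
    moreover have "q ^ Suc n * Z ^ Suc (Suc n) \<le> (\<Sum>v\<in>V. exp (bval ?S \<phi> v))"
    proof -
      have "Z \<ge> 0" by (simp add: Z_def sum_nonneg)
      then have "q * (q ^ n * Z ^ Suc n) * Z \<le> q * (\<Sum>w\<in>W. exp (bval ?S \<phi> w)) * Z"
        using W(4) q(1) by (intro mult_right_mono mult_left_mono) auto
      also note V(4)
      finally show ?thesis by (simp add: algebra_simps)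
    qed
    ultimately show ?case using V(1,2) by (intro exI[of _ V]) blast
  qed
  have "ereal l \<le> restricted_pressure I A \<eta> K \<psi> \<phi> D"
  proof (rule ccontr)
    let ?E = "D \<inter> words_meeting I A K"
    assume "\<not> ?thesis"
    then have "induced_pressure \<eta> K \<psi> \<phi> ?E < ereal l" by (simp add: restricted_pressure_def)
    then have "\<exists>T1. \<forall>T\<ge>T1. \<forall>F. finite F \<longrightarrow> F \<subseteq> word_window \<eta> K \<psi> ?E T \<longrightarrow>
        (\<Sum>w\<in>F. exp (bval K \<phi> w)) \<le> exp (l * T)"
      by (rule induced_pressure_lessD[OF \<psi> \<phi> K(2)])
    then obtain T1 where T1: "\<forall>T\<ge>T1. \<forall>F. finite F \<longrightarrow> F \<subseteq> word_window \<eta> K \<psi> ?E T \<longrightarrow>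
        (\<Sum>w\<in>F. exp (bval K \<phi> w)) \<le> exp (l * T)" ..
    \<comment> \<open>With \<open>N\<close> blocks the \<open>\<psi>\<close>-values spread over at
      most \<open>c * N + 1\<close> windows. This linear count and the factor \<open>exp M'\<close>
      are beaten by \<open>exp N\<close> for large \<open>n\<close>.\<close>
    define c where "c = 2 * R' / \<eta>"
    have "c > 0" using R \<eta> by (simp add: c_def)
    then have "(\<lambda>n. exp M' * (c * real (Suc n) + 1) / exp (real (Suc n))) \<longlonglongrightarrow> 0"
      by real_asymp
    then have "\<forall>\<^sub>F n in sequentially. exp M' * (c * real (Suc n) + 1) / exp (real (Suc n)) < 1"
      by (rule order_tendstoD) simp
    moreover have "\<forall>\<^sub>F n in sequentially. T1 \<le> real (Suc n)"
      by (rule eventually_sequentiallyI[of "nat \<lceil>T1\<rceil>"]) linarith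
    ultimately have "\<forall>\<^sub>F n in sequentially. exp M' * (c * real (Suc n) + 1) / exp (real (Suc n)) < 1
        \<and> T1 \<le> real (Suc n)" by eventually_elim simp
    then obtain n where n: "exp M' * (c * real (Suc n) + 1) < exp (real (Suc n))" "T1 \<le> real (Suc n)"
      by (auto simp: eventually_sequentially field_simps)
    define N where "N = real (Suc n)"
    have N: "N \<ge> 1" by (simp add: N_def)
    obtain W where W: "finite W" "W \<subseteq> D"
      "\<And>w. w \<in> W \<Longrightarrow> set w \<subseteq> J \<and> \<bar>bval ?S \<psi> w - N * T\<bar> \<le> N * R"
      "q ^ n * Z ^ Suc n \<le> (\<Sum>w\<in>W. exp (bval ?S \<phi> w))" using iter[of n] unfolding N_def by blast
    have WK: "cylinder K w \<noteq> {}" "w \<in> ?E" if w: "w \<in> W" for w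
    proof -
      show *: "cylinder K w \<noteq> {}" using neK[of w] W(2,3) w by blast
      then obtain x where "x \<in> cylinder K w" by blast
      then have "x \<in> cylinder ?S w \<inter> K" using K(2) by (auto simp: cylinder_def)
      then show "w \<in> ?E" using w W(2) D(1) by (auto simp: words_meeting_def)
    qed
    have range: "N * (T - R') \<le> bval K \<psi> w \<and> bval K \<psi> w \<le> N * (T + R')" if w: "w \<in> W" for w
    proof -
      have "\<bar>bval K \<psi> w - bval ?S \<psi> w\<bar> \<le> M" by (rule bval_change_space[OF \<psi> K(2) WK(1)[OF w]])
      moreover have "M \<le> N * M" using mult_right_mono[OF N M] by simp
      moreover have "N * (T - R') = N * T - N * R - N * M" "N * (T + R') = N * T + N * R + N * M"
        by (simp_all add: R'_def algebra_simps)
      ultimately show ?thesis using conjunct2[OF W(3)[OF w]] by (auto simp: abs_le_iff)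
    qed
    have window: "(\<Sum>w\<in>{w \<in> W. s - \<eta> < bval K \<psi> w \<and> bval K \<psi> w \<le> s}. exp (bval K \<phi> w))
        \<le> exp (N * (l * T + \<bar>l\<bar> * R'))" if s: "N * (T - R') \<le> s" "s \<le> N * (T + R')" for s
    proof -
      \<comment> \<open>Since \<open>T - R' \<ge> 1\<close>, every relevant window lies beyond
        \<open>N\<close>, and hence beyond \<open>T1\<close>.\<close>
      have "N * 1 \<le> N * (T - R')" using T N by (intro mult_left_mono) auto
      then have "T1 \<le> s" using s(1) n(2)[folded N_def] by linarith
      moreover have "{w \<in> W. s - \<eta> < bval K \<psi> w \<and> bval K \<psi> w \<le> s} \<subseteq> word_window \<eta> K \<psi> ?E s"
        using WK by (auto simp: word_window_def)
      ultimately have "(\<Sum>w\<in>{w \<in> W. s - \<eta> < bval K \<psi> w \<and> bval K \<psi> w \<le> s}. exp (bval K \<phi> w)) \<le> exp (l * s)"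
        using W(1) by (intro T1[rule_format]) auto
      also have "l * s \<le> N * (l * T + \<bar>l\<bar> * R')"
      proof -
        have "\<bar>s - N * T\<bar> \<le> N * R'" using s by (auto simp: algebra_simps abs_le_iff)
        then have "\<bar>l * (s - N * T)\<bar> \<le> \<bar>l\<bar> * (N * R')" by (simp add: abs_mult mult_left_mono)
        then have "l * (s - N * T) \<le> \<bar>l\<bar> * (N * R')" by (rule abs_le_D1)
        moreover have "l * s = l * (s - N * T) + N * (l * T)" by (simp add: algebra_simps)
        moreover have "N * (l * T + \<bar>l\<bar> * R') = \<bar>l\<bar> * (N * R') + N * (l * T)"
          by (simp add: algebra_simps)
        ultimately show ?thesis by simp
      qed
      finally show ?thesis by simp
    qed
    have "exp (N * (l' * T - \<bar>ln q\<bar>)) \<le> q ^ n * Z ^ Suc n"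
    proof -
      have "N * (l' * T - \<bar>ln q\<bar>) \<le> real n * ln q + N * (l' * T)"
      proof -
        have "- (real n * ln q) \<le> real n * \<bar>ln q\<bar>" using mult_left_mono[of "- ln q" "\<bar>ln q\<bar>" "real n"] by simp
        also have "\<dots> \<le> N * \<bar>ln q\<bar>" by (simp add: N_def mult_right_mono)
        finally show ?thesis by (simp add: algebra_simps)
      qed
      moreover have "exp (real n * ln q) * exp (l' * T) ^ Suc n = exp (real n * ln q + N * (l' * T))"
        unfolding N_def exp_add exp_of_nat_mult ..
      ultimately have "exp (N * (l' * T - \<bar>ln q\<bar>)) \<le> exp (real n * ln q) * exp (l' * T) ^ Suc n"
        by simp
      also have "exp (real n * ln q) = q ^ n" using q(1) by (simp add: exp_of_nat_mult)
      also have "exp (l' * T) ^ Suc n \<le> Z ^ Suc n" using Z by (intro power_mono) (auto simp: Z_def)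
      finally show ?thesis using q(1) by (simp add: mult_left_mono)
    qed
    also note W(4)
    also have "(\<Sum>w\<in>W. exp (bval ?S \<phi> w)) \<le> (\<Sum>w\<in>W. exp M' * exp (bval K \<phi> w))"
    proof (rule sum_mono)
      fix w assume "w \<in> W"
      from bval_change_space[OF \<phi> K(2) WK(1)[OF this]]
      show "exp (bval ?S \<phi> w) \<le> exp M' * exp (bval K \<phi> w)" by (simp flip: exp_add)
    qed
    also have "\<dots> = exp M' * (\<Sum>w\<in>W. exp (bval K \<phi> w))" by (simp add: sum_distrib_left)
    also have "(\<Sum>w\<in>W. exp (bval K \<phi> w))
        \<le> ((N * (T + R') - N * (T - R')) / \<eta> + 1) * exp (N * (l * T + \<bar>l\<bar> * R'))"
    proof (rule sum_window_cover[where \<beta> = "bval K \<psi>", OF W(1) \<eta> range])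
      show "N * (T - R') \<le> N * (T + R')" using N R by (intro mult_left_mono) auto
    qed (use window in auto)
    also have "(N * (T + R') - N * (T - R')) / \<eta> + 1 = c * N + 1"
      by (simp add: c_def algebra_simps)
    finally have "exp (N * (l' * T - \<bar>ln q\<bar>)) \<le> exp M' * ((c * N + 1) * exp (N * (l * T + \<bar>l\<bar> * R')))"
      by (simp add: mult_left_mono)
    also have "\<dots> = exp M' * (c * N + 1) * exp (N * (l * T + \<bar>l\<bar> * R'))" by simp
    also have "\<dots> < exp N * exp (N * (l * T + \<bar>l\<bar> * R'))"
      using n(1) unfolding N_def by (intro mult_strict_right_mono) auto
    also have "\<dots> = exp (N * (l * T + \<bar>l\<bar> * R' + 1))" by (simp add: algebra_simps flip: exp_add)
    finally have "N * (l' * T - \<bar>ln q\<bar>) < N * (l * T + \<bar>l\<bar> * R' + 1)" by simp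
    then have "l' * T - \<bar>ln q\<bar> < l * T + \<bar>l\<bar> * R' + 1" using N by simp
    moreover have "\<bar>ln q\<bar> + \<bar>l\<bar> * R' + 1 \<le> T * (l' - l)"
      using T l'(1) by (simp add: pos_divide_le_eq)
    ultimately show False by (simp add: algebra_simps)
  qed
  then show ?thesis using K(1) by blast
qed

section \<open>The supremum formula and the exhausting principle\<close>

text \<open>Makes the family of compact invariant sets nonempty, which is required to extract a
  sequence approaching the supremum.\<close>

lemma empty_compact_invariant: "compact_invariant I A {}"
  using finite_alphabet_compact_invariant[of "{}" I A] by simp

theorem theorem3p12:
  fixes I :: "nat set" and A :: "nat \<Rightarrow> nat \<Rightarrow> nat" and \<eta> :: real
    and \<phi> \<psi> :: "(nat \<Rightarrow> nat) \<Rightarrow> real" and C C' :: "nat list set"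
  assumes "\<forall>i\<in>I. \<forall>j\<in>I. A i j \<in> {0, 1}"
    and "\<eta> > 0"
    and "holder_continuous I A \<phi>" and "holder_continuous I A \<psi>"
    and "\<forall>\<omega>\<in>shift_space I A. \<psi> \<omega> > 0"
    and "C' \<subseteq> C" and "C \<subseteq> admissible_words I A"
    and "finitely_irreducible I A C'" and "representable_by_loops I A C'"
    and "compactly_finitely_embeddable I A C C'"
  shows "(SUP K \<in> {K. compact_invariant I A K}. restricted_pressure I A \<eta> K \<psi> \<phi> C)
           = induced_pressure \<eta> (shift_space I A) \<psi> \<phi> C'
    \<and> (exhausting_principle I A \<eta> \<psi> \<phi> C \<longleftrightarrow>
         induced_pressure \<eta> (shift_space I A) \<psi> \<phi> C
           = induced_pressure \<eta> (shift_space I A) \<psi> \<phi> C')"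
proof -
  let ?\<K> = "{K. compact_invariant I A K}"
  let ?r = "\<lambda>K. restricted_pressure I A \<eta> K \<psi> \<phi> C"
  let ?p = "induced_pressure \<eta> (shift_space I A) \<psi> \<phi>"
  have C': "C' \<subseteq> admissible_words I A" using assms(6,7) by blast
  obtain M where \<psi>: "distortion_bound I A \<psi> M" using holder_distortion_bound[OF assms(4)] .
  obtain M' where \<phi>: "distortion_bound I A \<phi> M'" using holder_distortion_bound[OF assms(3)] .
  have upper: "?r K \<le> ?p C'" if "compact_invariant I A K" for K
    using that assms(10) restricted_pressure_le[OF \<psi> \<phi> assms(2) C' assms(8)]
    by (auto simp: compact_invariant_def compactly_finitely_embeddable_def)
  have sup: "(SUP K \<in> ?\<K>. ?r K) = ?p C'"
  proof (rule antisym)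
    show "(SUP K \<in> ?\<K>. ?r K) \<le> ?p C'" by (intro SUP_least) (auto intro: upper)
    show "?p C' \<le> (SUP K \<in> ?\<K>. ?r K)"
    proof (rule ccontr)
      assume "\<not> ?thesis"
      then obtain l where l: "(SUP K \<in> ?\<K>. ?r K) < ereal l" "ereal l < ?p C'"
        unfolding not_le using ereal_dense2 by blast
      obtain K where K: "compact_invariant I A K" "ereal l \<le> restricted_pressure I A \<eta> K \<psi> \<phi> C'"
        using finite_alphabet_pressure_ge[OF assms(4,3,5,2) C' assms(8) l(2)] by blast
      \<comment> \<open>The set found for \<open>C'\<close> also serves \<open>C\<close>, since
        enlarging the collection only adds terms to the sums.\<close>
      have "restricted_pressure I A \<eta> K \<psi> \<phi> C' \<le> ?r K"
        unfolding restricted_pressure_def using assms(6) by (intro induced_pressure_mono) auto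
      also have "\<dots> \<le> (SUP K \<in> ?\<K>. ?r K)" using K(1) by (intro SUP_upper) auto
      finally show False using K(2) l(1) by simp
    qed
  qed
  have "exhausting_principle I A \<eta> \<psi> \<phi> C \<longleftrightarrow> ?p C = ?p C'"
  proof
    assume "exhausting_principle I A \<eta> \<psi> \<phi> C"
    then obtain K where "\<And>n. compact_invariant I A (K n)" "(\<lambda>n. ?r (K n)) \<longlonglongrightarrow> ?p C"
      unfolding exhausting_principle_def by blast
    \<comment> \<open>Each term of the sequence is at most \<open>?p C'\<close>, so the limit is
      too; the reverse inequality is monotonicity in the collection.\<close>
    then have "?p C \<le> ?p C'" using upper by (intro LIMSEQ_le_const2) auto
    then show "?p C = ?p C'" using induced_pressure_mono[OF assms(6)] by (rule antisym)
  next
    assume eq: "?p C = ?p C'"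
    have "?\<K> \<noteq> {}" using empty_compact_invariant by blast
    \<comment> \<open>Only the pressures increase along this sequence; the sets realising them are
      chosen one by one and need not be nested.\<close>
    then obtain f where f: "incseq f" "range f \<subseteq> ?r ` ?\<K>" "(SUP K \<in> ?\<K>. ?r K) = (SUP n. f n)"
      using Sup_countable_SUP[of "?r ` ?\<K>"] by blast
    have "\<exists>K. compact_invariant I A K \<and> ?r K = f n" for n
    proof -
      have "f n \<in> ?r ` ?\<K>" using f(2) by (rule subsetD) simp
      then show ?thesis by (elim imageE) auto
    qed
    then obtain K where K: "compact_invariant I A (K n) \<and> ?r (K n) = f n" for n
      using choice[of "\<lambda>n K. compact_invariant I A K \<and> ?r K = f n"] by auto
    have "f \<longlonglongrightarrow> ?p C" using LIMSEQ_SUP[OF f(1)] f(3) sup eq by simp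
    then show "exhausting_principle I A \<eta> \<psi> \<phi> C"
      unfolding exhausting_principle_def using K by (intro exI[of _ K]) simp
  qed
  with sup show ?thesis by blast
qed

end
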